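(* Let $n=2$, let $\Omega=B_1$ be the open unit ball of $\mathbb{R}^2$, let $\gamma$ be a smooth radial function on $\overline{B_1}$ and let $c=\nabla\gamma$. Then for every function $f:[0,1)\to\mathbb{R}_+$ that is $C^2$, positive, nondecreasing and convex in $[0,1)$ with $\lim_{t\to1^-}f(t)=\infty$, the extremal solution $u^*$ of the problem $(P_\lambda)$ is regular.
   Context: For $\lambda>0$, $(P_\lambda)$ is the problem $-\Delta u+c(x)\cdot\nabla u=\lambda f(u)$ in $\Omega$, $u>0$ in $\Omega$, $u=0$ on $\partial\Omega$. A solution $u$ is called regular if $u\in C^2(\overline{\Omega})$. A weak solution of $(P_\lambda)$ is a function $u$ with $0\le u\le1$ a.e. in $\Omega$, $f(u)\,d(x,\partial\Omega)\in L^1(\Omega)$ (with $f(1)=+\infty$), and $-\int_\Omega u\Delta\phi-\int_\Omega u\,\mathrm{div}(\phi c)=\lambda\int_\Omega f(u)\phi$ for all $\phi\in C^2(\overline{\Omega})\cap H_0^1(\Omega)$; a weak solution with $\sup_\Omega u<1$ is regular. There is $\lambda^*\in(0,\infty)$ (the supremum of the $\lambda>0$ for which $(P_\lambda)$ has a regular solution) such that for $0<\lambda<\lambda^*$ the problem $(P_\lambda)$ has a minimal solution $u_\lambda$ (i.e. $u_\lambda\le v$ for any solution $v$), which is regular, and $\lambda\mapsto u_\lambda$ is increasing. The extremal solution is $u^*:=\lim_{\lambda\to\lambda^*}u_\lambda$, the unique weak solution of $(P_{\lambda^*})$. *)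

theory Defs
  imports "HOL-Analysis.Analysis"
begin

definition partial :: "'n \<Rightarrow> (real ^ 'n \<Rightarrow> real) \<Rightarrow> real ^ 'n \<Rightarrow> real" where
  "partial i u x = frechet_derivative u (at x) (axis i 1)"

definition grad :: "(real ^ 'n \<Rightarrow> real) \<Rightarrow> real ^ 'n \<Rightarrow> real ^ 'n" where
  "grad u x = (\<chi> i. partial i u x)"

definition divergence :: "(real ^ 'n \<Rightarrow> real ^ 'n) \<Rightarrow> real ^ 'n \<Rightarrow> real" where
  "divergence V x = (\<Sum>i\<in>UNIV. partial i (\<lambda>y. V y $ i) x)"

definition laplacian :: "(real ^ 'n \<Rightarrow> real) \<Rightarrow> real ^ 'n \<Rightarrow> real" where
  "laplacian u x = (\<Sum>i\<in>UNIV. partial i (partial i u) x)"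

(* All partial derivatives of order at most k exist in the open set \<Omega> and extend continuously
   to its closure; the values of u off \<Omega> play no role. *)
primrec Ck_extends :: "nat \<Rightarrow> (real ^ 'n) set \<Rightarrow> (real ^ 'n \<Rightarrow> real) \<Rightarrow> bool" where
  "Ck_extends 0 \<Omega> u \<longleftrightarrow>
     (\<exists>g. continuous_on (closure \<Omega>) g \<and> (\<forall>x\<in>\<Omega>. g x = u x))"
| "Ck_extends (Suc k) \<Omega> u \<longleftrightarrow>
     (\<exists>g. continuous_on (closure \<Omega>) g \<and> (\<forall>x\<in>\<Omega>. g x = u x)) \<and>
     (\<forall>x\<in>\<Omega>. u differentiable (at x)) \<and>
     (\<forall>i. Ck_extends k \<Omega> (partial i u))"

(* C^k(closure \<Omega>), for open \<Omega> *)
definition Ck_closure :: "nat \<Rightarrow> (real ^ 'n) set \<Rightarrow> (real ^ 'n \<Rightarrow> real) \<Rightarrow> bool" where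
  "Ck_closure k \<Omega> u \<longleftrightarrow> continuous_on (closure \<Omega>) u \<and> Ck_extends k \<Omega> u"

definition smooth_closure :: "(real ^ 'n) set \<Rightarrow> (real ^ 'n \<Rightarrow> real) \<Rightarrow> bool" where
  "smooth_closure \<Omega> u \<longleftrightarrow> (\<forall>k. Ck_closure k \<Omega> u)"

definition radial_on :: "(real ^ 'n) set \<Rightarrow> (real ^ 'n \<Rightarrow> real) \<Rightarrow> bool" where
  "radial_on S u \<longleftrightarrow> (\<exists>h. \<forall>x\<in>S. u x = h (norm x))"

definition test_function :: "(real ^ 'n) set \<Rightarrow> (real ^ 'n \<Rightarrow> real) \<Rightarrow> bool" where
  "test_function \<Omega> \<psi> \<longleftrightarrow> smooth_closure UNIV \<psi> \<and>
     (\<exists>K. compact K \<and> K \<subseteq> \<Omega> \<and> (\<forall>x. x \<notin> K \<longrightarrow> \<psi> x = 0))"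

(* Membership in H_0^1(\<Omega>), the H^1-closure of the test functions. It is only used for \<phi> in
   C^2(closure \<Omega>) with \<Omega> bounded, where the weak gradient is the classical one and all
   integrals are finite. *)
definition H10 :: "(real ^ 'n) set \<Rightarrow> (real ^ 'n \<Rightarrow> real) \<Rightarrow> bool" where
  "H10 \<Omega> \<phi> \<longleftrightarrow> (\<exists>\<psi> :: nat \<Rightarrow> real ^ 'n \<Rightarrow> real. (\<forall>k. test_function \<Omega> (\<psi> k)) \<and>
     (\<lambda>k. integral\<^sup>L (lebesgue_on \<Omega>)
        (\<lambda>x. (\<phi> x - \<psi> k x)\<^sup>2 + (norm (grad \<phi> x - grad (\<psi> k) x))\<^sup>2)) \<longlonglongrightarrow> 0)"

(* C^2 on the half-open interval [0,1), with one-sided derivatives at 0 *)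
definition C2_unit :: "(real \<Rightarrow> real) \<Rightarrow> bool" where
  "C2_unit f \<longleftrightarrow> (\<exists>f' f''.
     (\<forall>t\<in>{0..<1}. (f has_real_derivative f' t) (at t within {0..<1})) \<and>
     (\<forall>t\<in>{0..<1}. (f' has_real_derivative f'' t) (at t within {0..<1})) \<and>
     continuous_on {0..<1} f'')"

definition singular_nonlinearity :: "(real \<Rightarrow> real) \<Rightarrow> bool" where
  "singular_nonlinearity f \<longleftrightarrow> C2_unit f \<and> (\<forall>t\<in>{0..<1}. 0 < f t) \<and>
     mono_on {0..<1} f \<and> convex_on {0..<1} f \<and> filterlim f at_top (at_left 1)"

(* u < 1 in \<Omega> is part of the equation: f is only defined on [0,1). *)
definition regular_solution ::
  "(real ^ 'n) set \<Rightarrow> (real ^ 'n \<Rightarrow> real ^ 'n) \<Rightarrow> (real \<Rightarrow> real) \<Rightarrow> real \<Rightarrow> (real ^ 'n \<Rightarrow> real) \<Rightarrow> bool"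
where
  "regular_solution \<Omega> c f lam u \<longleftrightarrow> Ck_closure 2 \<Omega> u \<and>
     (\<forall>x\<in>\<Omega>. 0 < u x \<and> u x < 1 \<and> - laplacian u x + c x \<bullet> grad u x = lam * f (u x)) \<and>
     (\<forall>x\<in>frontier \<Omega>. u x = 0)"

(* f with the convention f(1) = +infinity *)
definition extended_nonlinearity :: "(real \<Rightarrow> real) \<Rightarrow> real \<Rightarrow> ennreal" where
  "extended_nonlinearity f t = (if t < 1 then ennreal (f t) else \<infinity>)"

(* The second line forces u < 1 almost everywhere, so in the last integral the value given to
   f at 1 is irrelevant. *)
definition weak_solution ::
  "(real ^ 'n) set \<Rightarrow> (real ^ 'n \<Rightarrow> real ^ 'n) \<Rightarrow> (real \<Rightarrow> real) \<Rightarrow> real \<Rightarrow> (real ^ 'n \<Rightarrow> real) \<Rightarrow> bool"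
where
  "weak_solution \<Omega> c f lam u \<longleftrightarrow>
     u \<in> borel_measurable (lebesgue_on \<Omega>) \<and> (AE x in lebesgue_on \<Omega>. 0 \<le> u x \<and> u x \<le> 1) \<and>
     (\<integral>\<^sup>+ x. extended_nonlinearity f (u x) * ennreal (infdist x (frontier \<Omega>)) \<partial>lebesgue_on \<Omega>) < \<infinity> \<and>
     (\<forall>\<phi>. Ck_closure 2 \<Omega> \<phi> \<and> H10 \<Omega> \<phi> \<longrightarrow>
        - (\<integral>x. u x * laplacian \<phi> x \<partial>lebesgue_on \<Omega>)
        - (\<integral>x. u x * divergence (\<lambda>y. \<phi> y *\<^sub>R c y) x \<partial>lebesgue_on \<Omega>)
        = lam * (\<integral>x. f (u x) * \<phi> x \<partial>lebesgue_on \<Omega>))"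

(* Regular, and below every solution of the problem, be it regular or weak *)
definition minimal_solution ::
  "(real ^ 'n) set \<Rightarrow> (real ^ 'n \<Rightarrow> real ^ 'n) \<Rightarrow> (real \<Rightarrow> real) \<Rightarrow> real \<Rightarrow> (real ^ 'n \<Rightarrow> real) \<Rightarrow> bool"
where
  "minimal_solution \<Omega> c f lam u \<longleftrightarrow> regular_solution \<Omega> c f lam u \<and>
     (\<forall>v. regular_solution \<Omega> c f lam v \<longrightarrow> (\<forall>x\<in>\<Omega>. u x \<le> v x)) \<and>
     (\<forall>v. weak_solution \<Omega> c f lam v \<longrightarrow> (AE x in lebesgue_on \<Omega>. u x \<le> v x))"

definition extremal_parameter ::
  "(real ^ 'n) set \<Rightarrow> (real ^ 'n \<Rightarrow> real ^ 'n) \<Rightarrow> (real \<Rightarrow> real) \<Rightarrow> real" where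
  "extremal_parameter \<Omega> c f = Sup {lam. 0 < lam \<and> (\<exists>u. regular_solution \<Omega> c f lam u)}"

(* u is the pointwise limit of the minimal solutions as lam increases to the extremal parameter *)
definition extremal_solution ::
  "(real ^ 'n) set \<Rightarrow> (real ^ 'n \<Rightarrow> real ^ 'n) \<Rightarrow> (real \<Rightarrow> real) \<Rightarrow> (real ^ 'n \<Rightarrow> real) \<Rightarrow> bool"
where
  "extremal_solution \<Omega> c f u \<longleftrightarrow> (\<exists>U :: real \<Rightarrow> real ^ 'n \<Rightarrow> real.
     (\<forall>lam. 0 < lam \<and> lam < extremal_parameter \<Omega> c f \<longrightarrow> minimal_solution \<Omega> c f lam (U lam)) \<and>
     (\<forall>x\<in>closure \<Omega>. ((\<lambda>lam. U lam x) \<longlongrightarrow> u x) (at_left (extremal_parameter \<Omega> c f))))"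

end

theory Submission
  imports Defs
begin

text \<open>
  Why the extremal solution is regular. Put \<open>a = exp (- \<gamma>)\<close> and \<open>b = a' / a = - \<gamma>'\<close>, as functions of the
  radius. For radial \<open>u\<close> and \<open>g = - u' / r\<close> the equation reads \<open>(r^2 a g)' = r a \<lambda> f(u)\<close>, so it is inverted
  by two integrations (\<open>slope\<close>, \<open>potential\<close>). Monotone iteration of this inverse from \<open>0\<close>, kept below a given
  regular solution by the minimum principle, yields a radial solution below it
  (\<open>radial_below_regular\<close>). Hence minimal solutions are radial and increase with the parameter. A
  constant barrier gives solutions for small parameters, comparison with the torsion function bounds the
  parameters, and everything becomes a question on \<open>[0,1]\<close>: the minimal
  solutions must stay below some \<open>m < 1\<close> as the parameter \<open>\<mu>\<close> tends to the extremal one. Once they do, the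
  limit passes through the two integrations (\<open>radial_solution_limit\<close>). As \<open>f\<close> blows up at \<open>1\<close> and \<open>u\<close>
  is largest at the centre, it is enough to bound \<open>\<mu> f(u(0))\<close> independently of \<open>\<mu>\<close>.

  This bound is where dimension two and minimality enter. If \<open>u\<close>, \<open>w\<close> are the minimal solutions for
  \<open>\<mu> < \<lambda>\<close>, then \<open>v = w - u\<close> is positive and, \<open>f\<close> being convex, satisfies
  \<open>- (r a v')' \<ge> r a \<mu> f'(u) v\<close>. A positive supersolution of the linearised equation gives the stability
  inequality, through the pointwise inequality
  \<open>(r a \<phi>^2 v' / v)' \<le> r a \<phi>'^2 - r a \<mu> f'(u) \<phi>^2\<close>. Take \<open>\<phi> = g \<zeta>\<close>. In the plane, with \<open>\<gamma> = 0\<close>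
  and \<open>\<zeta> = 1\<close>, the right-hand side is an exact derivative, and its boundary term at the origin is a multiple
  of \<open>g(0)^2 = (\<mu> f(u(0)) / 2)^2\<close>: the quantity to be bounded is controlled by data at a fixed radius. For
  general \<open>\<gamma>\<close> the factor \<open>\<zeta> = exp (K r^2 / 2)\<close> absorbs the extra term containing \<open>\<gamma>''\<close>.

  Collecting the boundary terms, with \<open>F = \<mu> f(u)\<close> and \<open>s = - r v' / v\<close>, gives the energy
  \<open>E = a exp (K r^2) g (F - (1 + r b) g + g s)\<close>. It is nondecreasing near the origin (\<open>energy_deriv\<close>), it
  equals \<open>a(0) F(0)^2 / 4\<close> at the origin, and at a fixed radius it is bounded because \<open>0 \<le> u \<le> 1\<close>
  (\<open>center_bound\<close>).
\<close>

section \<open>Radial functions of two continuous derivatives\<close>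

lemma partial_eqI:
  assumes "(u has_derivative D) (at x)"
  shows "partial i u x = D (axis i 1)"
  unfolding partial_def using frechet_derivative_at[OF assms] by simp

lemma has_real_derivative_line:
  fixes x :: "real ^ 'n"
  assumes "u differentiable (at (x + t *\<^sub>R axis i 1))"
  shows "((\<lambda>t. u (x + t *\<^sub>R axis i 1)) has_real_derivative partial i u (x + t *\<^sub>R axis i 1)) (at t)"
proof -
  have 1: "((\<lambda>t. x + t *\<^sub>R axis i 1) has_derivative (\<lambda>s. s *\<^sub>R axis i (1::real))) (at t)"
    by (auto intro!: derivative_eq_intros)
  have "(u has_derivative frechet_derivative u (at (x + t *\<^sub>R axis i 1))) (at (x + t *\<^sub>R axis i 1))"
    using assms frechet_derivative_works by blast
  from diff_chain_at[OF 1 this]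
  have "((\<lambda>t. u (x + t *\<^sub>R axis i 1)) has_derivative
      (\<lambda>s. frechet_derivative u (at (x + t *\<^sub>R axis i 1)) (s *\<^sub>R axis i 1))) (at t)"
    by (simp add: o_def)
  moreover have "linear (frechet_derivative u (at (x + t *\<^sub>R axis i 1)))"
    using assms linear_frechet_derivative by blast
  ultimately show ?thesis
    by (simp add: has_field_derivative_def partial_def linear_cmul mult.commute[of "partial _ _ _"]
        mult_commute_abs)
qed

lemma has_derivative_radial:
  fixes x :: "real ^ 'n"
  assumes "x \<noteq> 0" "(V has_real_derivative d) (at (norm x))"
  shows "((\<lambda>y. V (norm y)) has_derivative (\<lambda>h. d * (x \<bullet> h / norm x))) (at x)"
proof -
  have "(norm has_derivative (\<lambda>h. h \<bullet> sgn x)) (at x)"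
    using assms(1) by (rule has_derivative_norm)
  from diff_chain_at[OF this assms(2)[unfolded has_field_derivative_def]]
  show ?thesis by (simp add: o_def sgn_div_norm inner_commute divide_inverse mult_ac)
qed

lemma tendsto_norm_within_zero:
  fixes \<phi> :: "real \<Rightarrow> real"
  assumes "(\<phi> \<longlongrightarrow> l) (at 0 within {0..1})"
  shows "((\<lambda>x::real^'n. \<phi> (norm x)) \<longlongrightarrow> l) (at 0)"
proof (rule filterlim_compose[OF assms])
  have "\<forall>\<^sub>F x in at (0::real^'n). x \<in> ball 0 1 \<and> x \<noteq> 0"
    unfolding eventually_at by (rule exI[of _ 1]) (auto simp: dist_norm)
  then have "\<forall>\<^sub>F x in at (0::real^'n). norm x \<in> {0..1} - {0}"
    by eventually_elim auto
  moreover have "((\<lambda>x::real^'n. norm x) \<longlongrightarrow> 0) (at 0)"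
    by (rule tendsto_norm_zero) (rule tendsto_ident_at)
  ultimately show "filterlim norm (at 0 within {0..1}) (at (0::real^'n))"
    unfolding filterlim_at by (auto elim: eventually_mono)
qed

text \<open>
  With \<open>V' = - r g\<close> the gradient \<open>- g(|x|) x\<close> has no quotient by \<open>|x|\<close> left, so the only
  singular expression is \<open>x_i x_j / |x|^2\<close>, which is bounded and comes multiplied by \<open>k(|x|)\<close>. The hypothesis
  \<open>k 0 = 0\<close> removes the singularity at the origin.
\<close>
lemma radial_C2:
  fixes u :: "real ^ 'n \<Rightarrow> real" and V g k :: "real \<Rightarrow> real"
  assumes V: "\<And>r. r \<in> {0..1} \<Longrightarrow> (V has_real_derivative - (r * g r)) (at r within {0..1})"
    and g: "\<And>r. r \<in> {0<..<1} \<Longrightarrow> (g has_real_derivative k r / r) (at r)"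
    and gc: "continuous_on {0..1} g" and kc: "continuous_on {0..1} k" and k0: "k 0 = 0"
    and u: "\<And>x. x \<in> cball 0 1 \<Longrightarrow> u x = V (norm x)"
  shows "Ck_closure 2 (ball 0 1) u"
    and "x \<in> ball 0 1 \<Longrightarrow> grad u x = - g (norm x) *\<^sub>R x"
    and "x \<in> ball 0 1 \<Longrightarrow> laplacian u x = - (real CARD('n) * g (norm x) + k (norm x))"
proof -
  have closure: "closure (ball (0::real^'n) 1) = cball 0 1" by simp
  have nc: "continuous_on (cball (0::real^'n) 1) (\<lambda>x. \<phi> (norm x))" if "continuous_on {0..1} \<phi>"
    for \<phi> :: "real \<Rightarrow> real"
    by (rule continuous_on_compose2[OF that]) (auto intro!: continuous_intros)
  have Vc: "continuous_on {0..1} V"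
    using V by (meson DERIV_continuous continuous_on_eq_continuous_within)
  have gn: "continuous_on (cball (0::real^'n) 1) (\<lambda>x. g (norm x))"
    by (rule nc[OF gc])
  have uc: "continuous_on (cball 0 1) u"
    using nc[OF Vc] u[symmetric] by (rule continuous_on_eq)
  have du: "(u has_derivative (\<lambda>h. - g (norm x) * (x \<bullet> h))) (at x)" if x: "x \<in> ball 0 1" for x
  proof -
    have "((\<lambda>y. V (norm y)) has_derivative (\<lambda>h. - g (norm x) * (x \<bullet> h))) (at x)"
    proof (cases "x = 0")
      case True
      have V0: "((\<lambda>r. (V r - V 0) / r) \<longlongrightarrow> 0) (at 0 within {0..1})"
        using V[of 0] by (simp add: has_field_derivative_iff)
      have "((\<lambda>h::real^'n. norm (V (norm h) - V 0) / norm h) \<longlongrightarrow> 0) (at 0)"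
        using tendsto_norm_zero[OF tendsto_norm_within_zero[OF V0]] by simp
      then show ?thesis
        unfolding True has_derivative_at by (simp add: bounded_linear_zero)
    next
      case False
      have "norm x \<in> interior {0..1}" using False x by simp
      then have "(V has_real_derivative - (norm x * g (norm x))) (at (norm x))"
        using V[of "norm x"] interior_subset by (metis at_within_interior subsetD)
      from has_derivative_radial[OF False this]
      have "((\<lambda>y. V (norm y)) has_derivative (\<lambda>h. - (norm x * g (norm x)) * (x \<bullet> h / norm x))) (at x)" .
      moreover have "- (norm x * g (norm x)) * (x \<bullet> h / norm x) = - g (norm x) * (x \<bullet> h)" for h
        using False by simp
      ultimately show ?thesis by (simp only:)
    qed
    moreover have "\<And>y. y \<in> ball 0 1 \<Longrightarrow> V (norm y) = u y" using u by simp
    ultimately show ?thesis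
      by (rule has_derivative_transform_within_open[OF _ open_ball x])
  qed
  have p1: "partial i u x = - (g (norm x) * x $ i)" if "x \<in> ball 0 1" for i x
    using partial_eqI[OF du[OF that]] by (simp add: inner_axis)
  \<comment> \<open>the second partial derivatives; at the origin division by zero leaves the right value,
    since \<open>k 0 = 0\<close>\<close>
  let ?E = "\<lambda>i j (x::real^'n). - (g (norm x) * (if i = j then 1 else 0) + x $ i * x $ j / (norm x)\<^sup>2 * k (norm x))"
  have dp: "\<exists>D. (partial i u has_derivative D) (at x) \<and> (\<forall>j. D (axis j 1) = ?E i j x)"
    if x: "x \<in> ball 0 1" for i x
  proof -
    let ?D = "\<lambda>h::real^'n. - (g (norm x) * h $ i + x $ i * (k (norm x) * (x \<bullet> h) / (norm x)\<^sup>2))"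
    have "((\<lambda>y. - (g (norm y) * y $ i)) has_derivative ?D) (at x)"
    proof (cases "x = 0")
      case True
      have g0: "((\<lambda>r. g r - g 0) \<longlongrightarrow> 0) (at 0 within {0..1})"
        using gc by (simp add: continuous_on_def LIM_zero)
      have *: "((\<lambda>h::real^'n. \<bar>g (norm h) - g 0\<bar>) \<longlongrightarrow> 0) (at 0)"
        using tendsto_norm_zero[OF tendsto_norm_within_zero[OF g0]] by simp
      have "((\<lambda>h::real^'n. norm (- (g (norm h) * h $ i) + g 0 * h $ i) / norm h) \<longlongrightarrow> 0) (at 0)"
      proof (rule tendsto_sandwich[OF _ _ tendsto_const *])
        show "\<forall>\<^sub>F h::real^'n in at 0. norm (- (g (norm h) * h $ i) + g 0 * h $ i) / norm h
            \<le> \<bar>g (norm h) - g 0\<bar>"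
        proof (rule always_eventually, rule allI)
          fix h :: "real^'n"
          have "- (g (norm h) * h $ i) + g 0 * h $ i = - ((g (norm h) - g 0) * h $ i)"
            by (simp add: algebra_simps)
          then have "norm (- (g (norm h) * h $ i) + g 0 * h $ i) = \<bar>g (norm h) - g 0\<bar> * \<bar>h $ i\<bar>"
            by (simp only: real_norm_def abs_minus_cancel abs_mult)
          also have "\<dots> \<le> \<bar>g (norm h) - g 0\<bar> * norm h"
            by (rule mult_left_mono) (auto simp: component_le_norm_cart)
          finally show "norm (- (g (norm h) * h $ i) + g 0 * h $ i) / norm h \<le> \<bar>g (norm h) - g 0\<bar>"
            by (cases "h = 0") (auto simp: divide_le_eq)
        qed
      qed auto
      moreover have "bounded_linear (\<lambda>h::real^'n. - (g 0 * h $ i))"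
        by (intro bounded_linear_minus bounded_linear_const_mult bounded_linear_vec_nth)
      ultimately show ?thesis
        unfolding True has_derivative_at by simp
    next
      case False
      have "(g has_real_derivative k (norm x) / norm x) (at (norm x))"
        using g[of "norm x"] False x by simp
      from has_derivative_radial[OF False this]
      have "((\<lambda>y. g (norm y)) has_derivative (\<lambda>h. k (norm x) / norm x * (x \<bullet> h / norm x))) (at x)" .
      moreover have "((\<lambda>y. y $ i) has_derivative (\<lambda>h. h $ i)) (at x)"
        by (rule bounded_linear_imp_has_derivative) (rule bounded_linear_vec_nth)
      ultimately have "((\<lambda>y. - (g (norm y) * y $ i)) has_derivative
         (\<lambda>h. - (g (norm x) * h $ i + k (norm x) / norm x * (x \<bullet> h / norm x) * x $ i))) (at x)"
        by (intro has_derivative_minus has_derivative_mult)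
      moreover have "k (norm x) / norm x * (x \<bullet> h / norm x) * x $ i
          = x $ i * (k (norm x) * (x \<bullet> h) / (norm x)\<^sup>2)" for h
        by (simp add: power2_eq_square)
      ultimately show ?thesis by (simp only:)
    qed
    moreover have "\<And>y. y \<in> ball 0 1 \<Longrightarrow> - (g (norm y) * y $ i) = partial i u y"
      using p1 by simp
    ultimately have "(partial i u has_derivative ?D) (at x)"
      by (rule has_derivative_transform_within_open[OF _ open_ball x])
    moreover have "?D (axis j 1) = ?E i j x" for j
    proof -
      have "axis j (1::real) $ i = (if i = j then 1 else 0)" by (simp add: axis_def)
      then show ?thesis by (simp only: inner_axis) (simp add: mult_ac)
    qed
    ultimately show ?thesis by blast
  qed
  have p2: "partial j (partial i u) x = ?E i j x" if x: "x \<in> ball 0 1" for i j x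
  proof -
    obtain D where "(partial i u has_derivative D) (at x)" "D (axis j 1) = ?E i j x"
      using dp[OF x] by blast
    then show ?thesis using partial_eqI[of "partial i u" D x j] by simp
  qed
  have Ec: "continuous_on (cball 0 1) (?E i j)" for i j
  proof -
    have "continuous_on (cball 0 1) (\<lambda>x::real^'n. x $ i * x $ j / (norm x)\<^sup>2 * k (norm x))"
      unfolding continuous_on_eq_continuous_within
    proof
      fix x :: "real^'n" assume x: "x \<in> cball 0 1"
      have kx: "continuous (at x within cball 0 1) (\<lambda>x. k (norm x))"
        using nc[OF kc] x by (simp add: continuous_on_eq_continuous_within)
      show "continuous (at x within cball 0 1) (\<lambda>x. x $ i * x $ j / (norm x)\<^sup>2 * k (norm x))"
      proof (cases "x = 0")
        case True
        have *: "((\<lambda>x. \<bar>k (norm x)\<bar>) \<longlongrightarrow> 0) (at x within cball 0 1)"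
          using kx True k0 by (simp add: continuous_within tendsto_rabs_zero)
        have "((\<lambda>x. x $ i * x $ j / (norm x)\<^sup>2 * k (norm x)) \<longlongrightarrow> 0) (at x within cball 0 1)"
        proof (rule Lim_null_comparison[OF always_eventually *], rule allI)
          fix y :: "real^'n"
          have "\<bar>y $ i * y $ j\<bar> \<le> norm y * norm y"
            unfolding abs_mult by (intro mult_mono) (auto simp: component_le_norm_cart)
          then have "\<bar>y $ i * y $ j / (norm y)\<^sup>2\<bar> \<le> 1"
            by (auto simp: power2_eq_square divide_le_eq_1 zero_less_mult_iff)
          from mult_right_mono[OF this, of "\<bar>k (norm y)\<bar>"]
          show "norm (y $ i * y $ j / (norm y)\<^sup>2 * k (norm y)) \<le> \<bar>k (norm y)\<bar>"
            by (simp add: abs_mult)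
        qed
        then show ?thesis using True k0 by (simp add: continuous_within)
      next
        case False
        then show ?thesis using kx by (intro continuous_intros) auto
      qed
    qed
    then show ?thesis
      by (rule continuous_on_minus[OF continuous_on_add[OF continuous_on_mult[OF gn continuous_on_const]]])
  qed
  have p1c: "continuous_on (cball 0 1) (\<lambda>x::real^'n. - (g (norm x) * x $ i))" for i
    by (intro continuous_intros gn)
  show "Ck_closure 2 (ball 0 1) u"
    unfolding Ck_closure_def numeral_2_eq_2 Ck_extends.simps closure
  proof (intro conjI ballI allI)
    show "continuous_on (cball 0 1) u" by (rule uc)
    show "\<exists>g. continuous_on (cball 0 1) g \<and> (\<forall>x\<in>ball 0 1. g x = u x)" using uc by blast
    show "u differentiable at x" if "x \<in> ball 0 1" for x
      unfolding differentiable_def using du[OF that] by blast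
    show "\<exists>g. continuous_on (cball 0 1) g \<and> (\<forall>x\<in>ball 0 1. g x = partial i u x)" for i
      using p1c[of i] p1[of _ i] by (intro exI[of _ "\<lambda>x. - (g (norm x) * x $ i)"]) auto
    show "partial i u differentiable at x" if "x \<in> ball 0 1" for x i
      unfolding differentiable_def using dp[OF that, of i] by blast
    show "\<exists>g. continuous_on (cball 0 1) g \<and> (\<forall>x\<in>ball 0 1. g x = partial j (partial i u) x)" for i j
      using Ec[of i j] p2[of _ j i] by (intro exI[of _ "?E i j"]) auto
  qed
  show "grad u x = - g (norm x) *\<^sub>R x" if "x \<in> ball 0 1"
    unfolding grad_def using p1[OF that] by (simp add: vec_eq_iff)
  show "laplacian u x = - (real CARD('n) * g (norm x) + k (norm x))" if x: "x \<in> ball 0 1"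
  proof -
    have s: "(\<Sum>i\<in>UNIV. x $ i * x $ i) = (norm x)\<^sup>2"
      by (simp add: power2_norm_eq_inner inner_vec_def)
    have "laplacian u x = - (\<Sum>i\<in>UNIV. g (norm x) + x $ i * x $ i / (norm x)\<^sup>2 * k (norm x))"
      unfolding laplacian_def sum_negf[symmetric] p2[OF x] by simp
    also have "\<dots> = - (real CARD('n) * g (norm x) + (norm x)\<^sup>2 / (norm x)\<^sup>2 * k (norm x))"
      unfolding sum.distrib s[symmetric] sum_distrib_right sum_divide_distrib by simp
    also have "(norm x)\<^sup>2 / (norm x)\<^sup>2 * k (norm x) = k (norm x)"
      using k0 by (cases "x = 0") auto
    finally show ?thesis .
  qed
qed

section \<open>The minimum principle\<close>

lemma second_derivative_nonneg_at_min:
  fixes \<phi> \<psi> :: "real \<Rightarrow> real"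
  assumes e: "e > 0"
    and \<phi>: "\<And>t. \<bar>t\<bar> < e \<Longrightarrow> (\<phi> has_real_derivative \<psi> t) (at t)"
    and \<psi>: "(\<psi> has_real_derivative D) (at 0)"
    and min: "\<And>t. \<bar>t\<bar> < e \<Longrightarrow> \<phi> 0 \<le> \<phi> t"
  shows "\<psi> 0 = 0" "D \<ge> 0"
proof -
  show 0: "\<psi> 0 = 0"
    by (rule DERIV_local_min[OF \<phi>[of 0] e]) (use e min in auto)
  show "D \<ge> 0"
  proof (rule ccontr)
    assume "\<not> D \<ge> 0"
    with DERIV_neg_dec_right[OF \<psi>] 0 obtain d where d: "d > 0" "\<And>h. 0 < h \<Longrightarrow> h < d \<Longrightarrow> \<psi> h < 0"
      by auto
    define t where "t = min d e / 2"
    have t: "0 < t" "t < d" "t < e" using d(1) e by (auto simp: t_def)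
    have "\<exists>z. 0 < z \<and> z < t \<and> \<phi> t - \<phi> 0 = (t - 0) * \<psi> z"
      by (rule MVT2[OF t(1)]) (use t \<phi> in auto)
    then obtain z where "0 < z" "z < t" "\<phi> t - \<phi> 0 = t * \<psi> z" by auto
    moreover from this have "\<psi> z < 0" using d t by simp
    ultimately have "\<phi> t < \<phi> 0" using t(1) mult_pos_neg[of t "\<psi> z"] by simp
    then show False using min[of t] t by simp
  qed
qed

text \<open>
  At a negative minimum, which would be interior, the gradient vanishes, and the advection
  term with it, while each pure second derivative is nonnegative.
\<close>
lemma strict_minimum_principle:
  fixes z :: "real ^ 'n \<Rightarrow> real"
  assumes \<Omega>: "open \<Omega>" "bounded \<Omega>"
    and cont: "continuous_on (closure \<Omega>) z" and bdry: "\<And>x. x \<in> frontier \<Omega> \<Longrightarrow> 0 \<le> z x"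
    and d1: "\<And>x. x \<in> \<Omega> \<Longrightarrow> z differentiable (at x)"
    and d2: "\<And>i x. x \<in> \<Omega> \<Longrightarrow> partial i z differentiable (at x)"
    and super: "\<And>x. x \<in> \<Omega> \<Longrightarrow> 0 < - laplacian z x + c x \<bullet> grad z x"
    and x: "x \<in> closure \<Omega>"
  shows "0 \<le> z x"
proof (rule ccontr)
  assume neg: "\<not> 0 \<le> z x"
  have "compact (closure \<Omega>)" using \<Omega> by (simp add: compact_closure)
  moreover have "closure \<Omega> \<noteq> {}" using x by auto
  ultimately obtain x0 where x0: "x0 \<in> closure \<Omega>" "\<And>y. y \<in> closure \<Omega> \<Longrightarrow> z x0 \<le> z y"
    using continuous_attains_inf[OF _ _ cont] by blast
  then have "z x0 < 0" using x neg by fastforce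
  then have "x0 \<in> \<Omega>"
    using bdry[of x0] x0(1) \<Omega> by (force simp: frontier_def interior_open)
  then obtain e where e: "e > 0" "ball x0 e \<subseteq> \<Omega>" using \<Omega> open_contains_ball by blast
  have line: "x0 + t *\<^sub>R axis i 1 \<in> \<Omega>" if "\<bar>t\<bar> < e" for t i
  proof -
    have "dist x0 (x0 + t *\<^sub>R axis i 1) < e" using that by (simp add: dist_norm norm_axis_1)
    then show ?thesis using e by auto
  qed
  have "partial i z x0 = 0 \<and> 0 \<le> partial i (partial i z) x0" for i
  proof -
    have 1: "((\<lambda>t. z (x0 + t *\<^sub>R axis i 1)) has_real_derivative partial i z (x0 + t *\<^sub>R axis i 1)) (at t)"
      if "\<bar>t\<bar> < e" for t
      by (rule has_real_derivative_line) (rule d1[OF line[OF that]])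
    have 2: "((\<lambda>t. partial i z (x0 + t *\<^sub>R axis i 1)) has_real_derivative
        partial i (partial i z) (x0 + 0 *\<^sub>R axis i 1)) (at 0)"
      by (rule has_real_derivative_line) (rule d2, use line[of 0] e in auto)
    have 3: "z (x0 + 0 *\<^sub>R axis i 1) \<le> z (x0 + t *\<^sub>R axis i 1)" if "\<bar>t\<bar> < e" for t
      using x0(2) line[OF that] closure_subset[of \<Omega>] by auto
    from second_derivative_nonneg_at_min[OF e(1) 1 2 3] show ?thesis by simp
  qed
  then have "grad z x0 = 0" "0 \<le> laplacian z x0"
    by (auto simp: grad_def vec_eq_iff laplacian_def intro!: sum_nonneg)
  with super[OF \<open>x0 \<in> \<Omega>\<close>] show False by simp
qed

lemma partial_add:
  assumes "u differentiable (at x)" "v differentiable (at x)"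
  shows "partial i (\<lambda>y. u y + v y) x = partial i u x + partial i v x"
proof -
  have "((\<lambda>y. u y + v y) has_derivative
      (\<lambda>h. frechet_derivative u (at x) h + frechet_derivative v (at x) h)) (at x)"
    using assms by (intro has_derivative_add) (auto simp: frechet_derivative_works)
  from partial_eqI[OF this] show ?thesis by (simp add: partial_def)
qed

lemma C2_add:
  fixes u v :: "real ^ 'n \<Rightarrow> real"
  assumes \<Omega>: "open \<Omega>" and x: "x \<in> \<Omega>"
    and u: "Ck_closure 2 \<Omega> u" and v: "Ck_closure 2 \<Omega> v"
  shows "(\<lambda>y. u y + v y) differentiable (at x)"
    and "partial i (\<lambda>y. u y + v y) differentiable (at x)"
    and "grad (\<lambda>y. u y + v y) x = grad u x + grad v x"
    and "laplacian (\<lambda>y. u y + v y) x = laplacian u x + laplacian v x"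
proof -
  have d1: "w differentiable (at y)" and d2: "partial i w differentiable (at y)"
    if "Ck_closure 2 \<Omega> w" "y \<in> \<Omega>" for w i y
    using that by (auto simp: Ck_closure_def numeral_2_eq_2)
  show "(\<lambda>y. u y + v y) differentiable (at x)"
    using d1[OF u x] d1[OF v x] by (rule differentiable_add)
  have p1: "partial i (\<lambda>y. u y + v y) y = partial i u y + partial i v y" if "y \<in> \<Omega>" for i y
    using that d1[OF u that] d1[OF v that] by (intro partial_add)
  have D: "(partial i (\<lambda>y. u y + v y) has_derivative
      (\<lambda>h. frechet_derivative (partial i u) (at x) h + frechet_derivative (partial i v) (at x) h)) (at x)"
    for i
  proof (rule has_derivative_transform_within_open[OF _ \<Omega> x])
    show "((\<lambda>y. partial i u y + partial i v y) has_derivative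
      (\<lambda>h. frechet_derivative (partial i u) (at x) h + frechet_derivative (partial i v) (at x) h)) (at x)"
      using d2[OF u x] d2[OF v x]
      by (intro has_derivative_add) (auto simp: frechet_derivative_works)
  qed (use p1 in auto)
  show "partial i (\<lambda>y. u y + v y) differentiable (at x)"
    unfolding differentiable_def using D by blast
  show "grad (\<lambda>y. u y + v y) x = grad u x + grad v x"
    using p1[OF x] by (simp add: grad_def vec_eq_iff)
  have "partial i (partial i (\<lambda>y. u y + v y)) x = partial i (partial i u) x + partial i (partial i v) x" for i
    using partial_eqI[OF D] by (simp add: partial_def)
  then show "laplacian (\<lambda>y. u y + v y) x = laplacian u x + laplacian v x"
    by (simp add: laplacian_def sum.distrib)
qed

section \<open>The radial Green operator\<close>

text \<open>
  For \<open>a = exp (- h)\<close> with \<open>\<gamma> x = h |x|\<close>, the operator \<open>- \<Delta> u + \<nabla>\<gamma> \<cdot> \<nabla>u\<close> acts on radial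
  functions as \<open>- (r a u')' / (r a)\<close>, and \<open>b = - h'\<close> is the logarithmic derivative of \<open>a\<close>. Derivatives are
  required in the open interval only, because \<open>\<gamma>\<close> is differentiable in the open ball.
\<close>
locale radial_weight =
  fixes a b :: "real \<Rightarrow> real"
  assumes a_pos: "\<And>r. r \<in> {0..1} \<Longrightarrow> 0 < a r"
    and a_cont: "continuous_on {0..1} a"
    and a_deriv: "\<And>r. r \<in> {0<..<1} \<Longrightarrow> (a has_real_derivative a r * b r) (at r)"
    and b_cont: "continuous_on {0..1} b"
begin

definition flux :: "(real \<Rightarrow> real) \<Rightarrow> real \<Rightarrow> real" where
  "flux h r = integral {0..r} (\<lambda>t. t * a t * h t)"

text \<open>
  The function \<open>- V' / r\<close> for the radial solution \<open>V\<close> with right-hand side \<open>h\<close>. The value at \<open>0\<close> is the limit: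
  the flux behaves like \<open>a(0) h(0) r^2 / 2\<close>.
\<close>
definition slope :: "(real \<Rightarrow> real) \<Rightarrow> real \<Rightarrow> real" where
  "slope h r = (if r = 0 then h 0 / 2 else flux h r / (r\<^sup>2 * a r))"

definition potential :: "(real \<Rightarrow> real) \<Rightarrow> real \<Rightarrow> real" where
  "potential h r = integral {r..1} (\<lambda>s. s * slope h s)"

lemma flux_integrand_cont:
  "continuous_on {0..1} h \<Longrightarrow> continuous_on {0..1} (\<lambda>t. t * a t * h t)"
  by (intro continuous_intros a_cont)

lemma flux_integrable:
  assumes "continuous_on {0..1} h" "r \<le> 1"
  shows "(\<lambda>t. t * a t * h t) integrable_on {0..r}"
  by (rule integrable_continuous_real, rule continuous_on_subset[OF flux_integrand_cont[OF assms(1)]])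
     (use assms in auto)

lemma flux_deriv:
  assumes "continuous_on {0..1} h" "r \<in> {0..1}"
  shows "(flux h has_real_derivative r * a r * h r) (at r within {0..1})"
  unfolding flux_def
  by (rule integral_has_real_derivative[OF flux_integrand_cont[OF assms(1)] assms(2)])

lemma flux_mono:
  assumes "continuous_on {0..1} h" "continuous_on {0..1} h'" "r \<le> 1"
    and "\<And>t. t \<in> {0..1} \<Longrightarrow> h t \<le> h' t"
  shows "flux h r \<le> flux h' r"
  unfolding flux_def
proof (rule integral_le)
  show "t * a t * h t \<le> t * a t * h' t" if "t \<in> {0..r}" for t
    using that assms a_pos[of t] by (intro mult_left_mono) auto
qed (use assms flux_integrable in auto)

lemma flux_diff:
  assumes "continuous_on {0..1} h" "continuous_on {0..1} h'" "r \<le> 1"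
  shows "flux (\<lambda>t. h t - h' t) r = flux h r - flux h' r"
  unfolding flux_def
  using integral_diff[OF flux_integrable flux_integrable, OF assms(1,3,2,3)]
  by (simp add: algebra_simps)

lemma flux_cmult: "flux (\<lambda>t. c * h t) r = c * flux h r"
proof -
  have "integral {0..r} (\<lambda>t. c * (t * a t * h t)) = c * integral {0..r} (\<lambda>t. t * a t * h t)"
    by simp
  then show ?thesis unfolding flux_def by (simp add: mult_ac)
qed

lemma flux_le_flux:
  assumes "continuous_on {0..1} h" "\<And>t. t \<in> {0..1} \<Longrightarrow> 0 \<le> h t" "0 \<le> r" "r \<le> s" "s \<le> 1"
  shows "flux h r \<le> flux h s"
  unfolding flux_def
proof (rule integral_subset_le)
  show "\<forall>t\<in>{0..s}. 0 \<le> t * a t * h t"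
    using assms less_imp_le[OF a_pos] by auto
qed (use assms flux_integrable in auto)

lemma flux_0 [simp]: "flux h 0 = 0"
  by (simp add: flux_def)

lemma slope_0 [simp]: "slope h 0 = h 0 / 2"
  by (simp add: slope_def)

lemma slope_cont:
  assumes h: "continuous_on {0..1} h"
  shows "continuous_on {0..1} (slope h)"
  unfolding continuous_on_eq_continuous_within
proof
  fix r :: real assume r: "r \<in> {0..1}"
  have fc: "continuous_on {0..1} (flux h)"
    using flux_deriv[OF h] by (meson DERIV_continuous continuous_on_eq_continuous_within)
  show "continuous (at r within {0..1}) (slope h)"
  proof (cases "r = 0")
    case False
    have "continuous (at r within {0..1}) (\<lambda>r. flux h r / (r\<^sup>2 * a r))"
      using False r a_pos[OF r] fc a_cont
      by (intro continuous_intros) (auto simp: continuous_on_eq_continuous_within)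
    then show ?thesis
    proof (rule continuous_transform_within)
      show "0 < r" using False r by simp
      show "flux h s / (s\<^sup>2 * a s) = slope h s" if "s \<in> {0..1}" "dist s r < r" for s
        using that by (auto simp: slope_def dist_real_def)
    qed (rule r)
  next
    case True
    have lim: "(\<phi> \<longlongrightarrow> \<phi> 0) (at_right 0)" if "continuous_on {0..1} \<phi>" for \<phi> :: "real \<Rightarrow> real"
      using that unfolding continuous_on_def
      by (metis (no_types) atLeastAtMost_iff at_within_Icc_at_right order_refl zero_le_one zero_less_one)
    have ev: "\<forall>\<^sub>F s in at_right (0::real). s \<in> {0<..<1}"
      using eventually_at_right_real[of 0 1] by simp
    have "((\<lambda>s. flux h s / s\<^sup>2) \<longlongrightarrow> a 0 * h 0 / 2) (at_right 0)"
    proof (rule lhopital_right_0[where f' = "\<lambda>s. s * a s * h s" and g' = "\<lambda>s. 2 * s"])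
      show "(flux h \<longlongrightarrow> 0) (at_right 0)" using lim[OF fc] by simp
      show "((\<lambda>s::real. s\<^sup>2) \<longlongrightarrow> 0) (at_right 0)"
        using lim[of "\<lambda>s. s\<^sup>2"] by (auto intro: continuous_intros)
      show "\<forall>\<^sub>F s in at_right 0. (flux h has_real_derivative s * a s * h s) (at s)"
        using ev
      proof eventually_elim
        case (elim s)
        then show ?case using flux_deriv[OF h, of s] by (simp add: at_within_Icc_at)
      qed
      show "\<forall>\<^sub>F s in at_right 0. ((\<lambda>s::real. s\<^sup>2) has_real_derivative 2 * s) (at s)"
        by (rule always_eventually) (auto intro!: derivative_eq_intros)
      show "\<forall>\<^sub>F s in at_right 0. (s::real)\<^sup>2 \<noteq> 0" "\<forall>\<^sub>F s in at_right 0. 2 * (s::real) \<noteq> 0"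
        using ev by (auto elim: eventually_mono)
      have "((\<lambda>s. a s * h s / 2) \<longlongrightarrow> a 0 * h 0 / 2) (at_right 0)"
        by (intro tendsto_intros lim a_cont h) auto
      then show "((\<lambda>s. s * a s * h s / (2 * s)) \<longlongrightarrow> a 0 * h 0 / 2) (at_right 0)"
        by (rule Lim_transform_eventually) (rule eventually_mono[OF ev], auto)
    qed
    from tendsto_divide[OF this lim[OF a_cont]] a_pos[of 0]
    have "((\<lambda>s. flux h s / s\<^sup>2 / a s) \<longlongrightarrow> h 0 / 2) (at_right 0)" by simp
    then have "(slope h \<longlongrightarrow> h 0 / 2) (at_right 0)"
      by (rule Lim_transform_eventually) (rule eventually_mono[OF ev], auto simp: slope_def)
    then show ?thesis
      using True by (simp add: continuous_within at_within_Icc_at_right)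
  qed
qed

text \<open>
  The equation in the variable \<open>g = - V' / r\<close>: differentiating \<open>r^2 a g\<close> gives
  \<open>r g' = h - (2 + r b) g\<close>.
\<close>
lemma slope_deriv:
  assumes h: "continuous_on {0..1} h" and r: "r \<in> {0<..<1}"
  shows "(slope h has_real_derivative (h r - (2 + r * b r) * slope h r) / r) (at r)"
proof -
  have "(flux h has_real_derivative r * a r * h r) (at r)"
    using flux_deriv[OF h, of r] r by (simp add: at_within_Icc_at)
  moreover have "((\<lambda>r. r\<^sup>2 * a r) has_real_derivative 2 * r * a r + r\<^sup>2 * (a r * b r)) (at r)"
    using a_deriv[OF r] by (auto intro!: derivative_eq_intros)
  moreover have nz: "r\<^sup>2 * a r \<noteq> 0" using a_pos[of r] r by auto
  ultimately have "((\<lambda>r. flux h r / (r\<^sup>2 * a r)) has_real_derivative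
      (r * a r * h r * (r\<^sup>2 * a r) - flux h r * (2 * r * a r + r\<^sup>2 * (a r * b r))) /
      (r\<^sup>2 * a r * (r\<^sup>2 * a r))) (at r)"
    by (rule DERIV_divide)
  moreover have "(r * a r * h r * (r\<^sup>2 * a r) - flux h r * (2 * r * a r + r\<^sup>2 * (a r * b r))) /
      (r\<^sup>2 * a r * (r\<^sup>2 * a r)) = (h r - (2 + r * b r) * slope h r) / r"
    using nz r by (simp add: slope_def field_simps power2_eq_square)
  ultimately have "((\<lambda>r. flux h r / (r\<^sup>2 * a r)) has_real_derivative
      (h r - (2 + r * b r) * slope h r) / r) (at r)" by simp
  then show ?thesis
    by (rule has_field_derivative_transform_within_open[of _ _ _ "{0<..<1}"])
       (use r in \<open>auto simp: slope_def\<close>)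
qed

lemma potential_integrand_cont:
  "continuous_on {0..1} h \<Longrightarrow> continuous_on {0..1} (\<lambda>s. s * slope h s)"
  by (intro continuous_intros slope_cont)

lemma potential_integrable:
  assumes "continuous_on {0..1} h" "0 \<le> r" "s \<le> 1"
  shows "(\<lambda>s. s * slope h s) integrable_on {r..s}"
  by (rule integrable_continuous_real, rule continuous_on_subset[OF potential_integrand_cont[OF assms(1)]])
     (use assms in auto)

lemma potential_deriv:
  assumes h: "continuous_on {0..1} h" and r: "r \<in> {0..1}"
  shows "(potential h has_real_derivative - (r * slope h r)) (at r within {0..1})"
proof -
  let ?J = "\<lambda>r. integral {0..r} (\<lambda>s. s * slope h s)"
  have "(?J has_real_derivative r * slope h r) (at r within {0..1})"
    by (rule integral_has_real_derivative[OF potential_integrand_cont[OF h] r])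
  then have "((\<lambda>r. ?J 1 - ?J r) has_real_derivative 0 - r * slope h r) (at r within {0..1})"
    by (intro DERIV_diff DERIV_const)
  moreover have "?J 1 - ?J r = potential h r" if "r \<in> {0..1}" for r
    using Henstock_Kurzweil_Integration.integral_combine[OF _ _ potential_integrable[OF h, of 0 1], of r] that
    by (simp add: potential_def)
  ultimately have "(potential h has_real_derivative 0 - r * slope h r) (at r within {0..1})"
    by (rule has_field_derivative_transform_within[OF _ zero_less_one r])
  then show ?thesis by simp
qed

lemma potential_cont: "continuous_on {0..1} h \<Longrightarrow> continuous_on {0..1} (potential h)"
  using potential_deriv by (meson DERIV_continuous continuous_on_eq_continuous_within)

lemma potential_1 [simp]: "potential h 1 = 0"
  by (simp add: potential_def)

lemma slope_mono:
  assumes "continuous_on {0..1} h" "continuous_on {0..1} h'" "r \<in> {0..1}"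
    and "\<And>t. t \<in> {0..1} \<Longrightarrow> h t \<le> h' t"
  shows "slope h r \<le> slope h' r"
  using flux_mono[OF assms(1,2) _ assms(4), of r] assms(3,4) a_pos[of r]
  by (auto simp: slope_def intro!: divide_right_mono)

lemma slope_diff:
  assumes "continuous_on {0..1} h" "continuous_on {0..1} h'" "r \<in> {0..1}"
  shows "slope (\<lambda>t. h t - h' t) r = slope h r - slope h' r"
  using flux_diff[OF assms(1,2), of r] assms(3) by (auto simp: slope_def diff_divide_distrib)

lemma slope_cmult: "slope (\<lambda>t. c * h t) r = c * slope h r"
  by (simp add: slope_def flux_cmult)

lemma potential_mono:
  assumes "continuous_on {0..1} h" "continuous_on {0..1} h'" "r \<in> {0..1}"
    and "\<And>t. t \<in> {0..1} \<Longrightarrow> h t \<le> h' t"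
  shows "potential h r \<le> potential h' r"
  unfolding potential_def
proof (rule integral_le)
  show "s * slope h s \<le> s * slope h' s" if "s \<in> {r..1}" for s
    using that slope_mono[OF assms(1,2) _ assms(4), of s] assms(3) by (intro mult_left_mono) auto
qed (use assms potential_integrable in auto)

lemma potential_diff:
  assumes "continuous_on {0..1} h" "continuous_on {0..1} h'" "r \<in> {0..1}"
  shows "potential (\<lambda>t. h t - h' t) r = potential h r - potential h' r"
proof -
  have "potential (\<lambda>t. h t - h' t) r = integral {r..1} (\<lambda>s. s * slope h s - s * slope h' s)"
    unfolding potential_def
    by (rule integral_cong) (use slope_diff assms in \<open>auto simp: right_diff_distrib\<close>)
  also have "\<dots> = potential h r - potential h' r"
    unfolding potential_def by (rule integral_diff) (use potential_integrable assms in auto)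
  finally show ?thesis .
qed

lemma potential_cmult: "potential (\<lambda>t. c * h t) r = c * potential h r"
proof -
  have "integral {r..1} (\<lambda>s. c * (s * slope h s)) = c * integral {r..1} (\<lambda>s. s * slope h s)" by simp
  then show ?thesis unfolding potential_def slope_cmult by (simp add: mult_ac)
qed

text \<open>
  By monotonicity and linearity it suffices to know the constant right-hand side \<open>1\<close>. The bound makes all
  potentials of uniformly bounded functions uniformly Lipschitz.
\<close>
lemma slope_bound:
  obtains C where "C > 0"
    "\<And>h M r. continuous_on {0..1} h \<Longrightarrow> (\<And>t. t \<in> {0..1} \<Longrightarrow> \<bar>h t\<bar> \<le> M) \<Longrightarrow> r \<in> {0..1}
      \<Longrightarrow> \<bar>slope h r\<bar> \<le> C * M"
proof -
  have one: "continuous_on {0..1::real} (\<lambda>_. 1::real)" by simp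
  have "compact (slope (\<lambda>_. 1) ` {0..1})"
    by (rule compact_continuous_image[OF slope_cont[OF one] compact_Icc])
  then obtain C where C: "C > 0" "\<And>r. r \<in> {0..1} \<Longrightarrow> \<bar>slope (\<lambda>_. 1) r\<bar> \<le> C"
    using compact_imp_bounded bounded_pos by (metis imageI real_norm_def)
  show ?thesis
  proof (rule that[OF C(1)])
    fix h :: "real \<Rightarrow> real" and M r
    assume h: "continuous_on {0..1} h" and le: "\<And>t. t \<in> {0..1} \<Longrightarrow> \<bar>h t\<bar> \<le> M" and r: "r \<in> {0..1::real}"
    have M: "0 \<le> M" using le[of 0] by auto
    have c: "continuous_on {0..1::real} (\<lambda>_. M * 1)" "continuous_on {0..1::real} (\<lambda>_. - M * 1)" by auto
    have "slope h r \<le> slope (\<lambda>_. M * 1) r"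
      by (rule slope_mono[OF h c(1) r]) (use le abs_le_iff in force)
    moreover have "slope (\<lambda>_. - M * 1) r \<le> slope h r"
      by (rule slope_mono[OF c(2) h r]) (use le abs_le_iff in force)
    ultimately have "\<bar>slope h r\<bar> \<le> M * \<bar>slope (\<lambda>_. 1) r\<bar>"
      unfolding slope_cmult using M
      by (smt (verit) abs_le_iff minus_mult_left mult_left_mono)
    also have "\<dots> \<le> M * C" using C(2)[OF r] M by (rule mult_left_mono)
    finally show "\<bar>slope h r\<bar> \<le> C * M" by (simp add: mult.commute)
  qed
qed

lemma potential_lipschitz:
  assumes h: "continuous_on {0..1} h" and L: "\<And>t. t \<in> {0..1} \<Longrightarrow> \<bar>slope h t\<bar> \<le> L"
    and r: "r \<in> {0..1}" "s \<in> {0..1}"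
  shows "\<bar>potential h r - potential h s\<bar> \<le> L * \<bar>r - s\<bar>"
proof -
  have "norm (potential h r - potential h s) \<le> L * norm (r - s)"
  proof (rule field_differentiable_bound[OF _ potential_deriv[OF h]])
    show "norm (- (t * slope h t)) \<le> L" if "t \<in> {0..1}" for t
      using L[OF that] that mult_mono[of t 1 "\<bar>slope h t\<bar>" L] by (simp add: abs_mult)
  qed (use r in auto)
  then show ?thesis by simp
qed

lemma potential_tendsto:
  assumes hn: "\<And>n. continuous_on {0..1} (h n)" and h: "continuous_on {0..1} h'"
    and M: "\<And>n t. t \<in> {0..1} \<Longrightarrow> \<bar>h n t\<bar> \<le> M"
    and lim: "\<And>t. t \<in> {0..1} \<Longrightarrow> (\<lambda>n. h n t) \<longlonglongrightarrow> h' t"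
    and r: "r \<in> {0..1}"
  shows "(\<lambda>n. potential (h n) r) \<longlonglongrightarrow> potential h' r"
proof -
  have M0: "0 \<le> M" using M[of 0 0] by auto
  have flux: "(\<lambda>n. flux (h n) s) \<longlonglongrightarrow> flux h' s" if s: "s \<in> {0..1}" for s
    unfolding flux_def
  proof (rule dominated_convergence(2)[where h = "\<lambda>t. t * a t * M"])
    show "norm (t * a t * h n t) \<le> t * a t * M" if "t \<in> {0..s}" for n t
    proof -
      have "t \<in> {0..1}" using that s by auto
      then show ?thesis using M[of t n] a_pos[of t]
        by (simp add: abs_mult mult_left_mono)
    qed
    show "(\<lambda>n. t * a t * h n t) \<longlonglongrightarrow> t * a t * h' t" if "t \<in> {0..s}" for t
      using that s by (intro tendsto_intros lim) auto
  qed (use s flux_integrable hn flux_integrable[of "\<lambda>_. M"] in auto)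
  have slope: "(\<lambda>n. slope (h n) s) \<longlonglongrightarrow> slope h' s" if s: "s \<in> {0..1}" for s
  proof (cases "s = 0")
    case True
    then show ?thesis using lim[of 0] by (auto intro!: tendsto_intros)
  next
    case False
    then show ?thesis
      using flux[OF s] a_pos[OF s] by (auto simp: slope_def intro!: tendsto_intros)
  qed
  obtain C where C: "C > 0"
    "\<And>h M r. continuous_on {0..1} h \<Longrightarrow> (\<And>t. t \<in> {0..1} \<Longrightarrow> \<bar>h t\<bar> \<le> M) \<Longrightarrow> r \<in> {0..1}
      \<Longrightarrow> \<bar>slope h r\<bar> \<le> C * M"
    using slope_bound by blast
  show ?thesis
    unfolding potential_def
  proof (rule dominated_convergence(2)[where h = "\<lambda>_. C * M"])
    show "norm (s * slope (h n) s) \<le> C * M" if "s \<in> {r..1}" for n s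
    proof -
      have s: "s \<in> {0..1}" using that r by auto
      from mult_mono[OF _ C(2)[OF hn M s], of s 1 n] s
      show ?thesis by (simp add: abs_mult)
    qed
    show "(\<lambda>n. s * slope (h n) s) \<longlonglongrightarrow> s * slope h' s" if "s \<in> {r..1}" for s
      using that r by (intro tendsto_intros slope) auto
  qed (use r potential_integrable[OF hn] in auto)
qed

lemma potential_solves:
  fixes c :: "real ^ 2 \<Rightarrow> real ^ 2"
  assumes h: "continuous_on {0..1} h"
    and c: "\<And>x. x \<in> ball 0 1 \<Longrightarrow> x \<noteq> 0 \<Longrightarrow> c x = - (b (norm x) / norm x) *\<^sub>R x"
    and u: "\<And>x. x \<in> cball 0 1 \<Longrightarrow> u x = potential h (norm x)"
  shows "Ck_closure 2 (ball 0 1) u"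
    and "x \<in> ball 0 1 \<Longrightarrow> - laplacian u x + c x \<bullet> grad u x = h (norm x)"
proof -
  let ?k = "\<lambda>r. h r - (2 + r * b r) * slope h r"
  have kc: "continuous_on {0..1} ?k"
    by (intro continuous_intros h b_cont slope_cont)
  have k0: "?k 0 = 0" by simp
  note R = radial_C2[of "potential h" "slope h" ?k, OF potential_deriv[OF h] slope_deriv[OF h]
      slope_cont[OF h] kc k0 u]
  show "Ck_closure 2 (ball 0 1) u" by (rule R(1)) auto
  show "- laplacian u x + c x \<bullet> grad u x = h (norm x)" if x: "x \<in> ball 0 1"
  proof -
    have "laplacian u x = - (2 * slope h (norm x) + ?k (norm x))"
      using R(3)[OF _ _ _ x] by simp
    moreover have "grad u x = - slope h (norm x) *\<^sub>R x"
      using R(2)[OF _ _ _ x] by simp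
    moreover have "c x \<bullet> (- slope h (norm x) *\<^sub>R x) = norm x * b (norm x) * slope h (norm x)"
    proof (cases "x = 0")
      case False
      then show ?thesis
        unfolding c[OF x False] by (simp add: dot_square_norm power2_eq_square)
    qed simp
    ultimately show ?thesis by (simp only:) (simp add: algebra_simps)
  qed
qed

end

section \<open>The bound at the centre\<close>

text \<open>
  The hypotheses on \<open>g\<close> and \<open>F\<close> are the equation and its derivative along a solution, with \<open>D = \<mu> f'(u)\<close>;
  the inequality for \<open>s = - r v' / v\<close> is the Riccati form of the supersolution property of \<open>v\<close>. Writing
  \<open>G = r g'\<close>, the derivative of the energy, multiplied by \<open>r / (a exp (K r^2))\<close>, is at least
  \<open>(G + g s + K r^2 g)^2 + r^2 g^2 (2 K - K^2 r^2 - b')\<close>. The coefficient \<open>2\<close> in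
  \<open>G = F - (2 + r b) g\<close> is the dimension; with it all terms without a factor \<open>r^2\<close> go into the square. The
  rest is nonnegative for \<open>K\<close> above \<open>b'\<close> on the disc \<open>K r^2 \<le> 1\<close>.
\<close>
lemma energy_deriv:
  fixes a b b' F g s D :: "real \<Rightarrow> real" and K r s' :: real
  assumes r: "0 < r" and a: "(a has_real_derivative a r * b r) (at r)" "0 < a r"
    and b: "(b has_real_derivative b' r) (at r)" "b' r \<le> K"
    and K: "0 \<le> K" "K * r\<^sup>2 \<le> 1"
    and g: "(g has_real_derivative (F r - (2 + r * b r) * g r) / r) (at r)"
    and F: "(F has_real_derivative - (r * D r * g r)) (at r)"
    and s: "(s has_real_derivative s') (at r)"
      "- (r * b r) * s r + (s r)\<^sup>2 + r\<^sup>2 * D r \<le> r * s'"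
  shows "\<exists>y. ((\<lambda>r. a r * exp (K * r\<^sup>2) * (g r * (F r - (1 + r * b r) * g r + g r * s r)))
    has_real_derivative y) (at r) \<and> 0 \<le> y"
proof -
  define P where "P = g r * (F r - (1 + r * b r) * g r + g r * s r)"
  define G where "G = F r - (2 + r * b r) * g r"
  define P' where "P' = (G / r) * (F r - (1 + r * b r) * g r + g r * s r)
    + g r * (- (r * D r * g r) - ((b r + r * b' r) * g r + (1 + r * b r) * (G / r)) + ((G / r) * s r + g r * s'))"
  let ?A = "a r * exp (K * r\<^sup>2)"
  have "((\<lambda>r. a r * exp (K * r\<^sup>2)) has_real_derivative ?A * (b r + 2 * K * r)) (at r)"
    using a(1) by (auto intro!: derivative_eq_intros simp: algebra_simps)
  moreover have "((\<lambda>r. g r * (F r - (1 + r * b r) * g r + g r * s r)) has_real_derivative P') (at r)"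
    unfolding P'_def G_def
    by (rule derivative_eq_intros g F s(1) b(1) refl)+ (simp add: algebra_simps)
  ultimately have D: "((\<lambda>r. a r * exp (K * r\<^sup>2) * (g r * (F r - (1 + r * b r) * g r + g r * s r)))
      has_real_derivative ?A * (b r + 2 * K * r) * P + P' * ?A) (at r)"
    unfolding P_def by (rule DERIV_mult)
  have Gr: "r * (G / r) = G" using r by simp
  have rP': "r * P' = G * (F r - (1 + r * b r) * g r + g r * s r)
    + g r * (- (r\<^sup>2 * D r * g r) - ((r * b r + r\<^sup>2 * b' r) * g r + (1 + r * b r) * G) + G * s r)
    + (g r)\<^sup>2 * (r * s')"
  proof -
    have "r * P' = (r * (G / r)) * (F r - (1 + r * b r) * g r + g r * s r)
    + g r * (- (r\<^sup>2 * D r * g r) - ((r * b r + r\<^sup>2 * b' r) * g r + (1 + r * b r) * (r * (G / r)))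
      + (r * (G / r)) * s r) + (g r)\<^sup>2 * (r * s')"
      unfolding P'_def by (simp only: power2_eq_square) algebra
    then show ?thesis unfolding Gr .
  qed
  have "0 \<le> (G + g r * s r + K * r\<^sup>2 * g r)\<^sup>2 + r\<^sup>2 * (g r)\<^sup>2 * (2 * K - K * (K * r\<^sup>2) - b' r)"
  proof -
    have "K * (K * r\<^sup>2) \<le> K" using K mult_left_mono[OF K(2) K(1)] by simp
    then have "0 \<le> 2 * K - K * (K * r\<^sup>2) - b' r" using b(2) by simp
    then show ?thesis by (intro add_nonneg_nonneg mult_nonneg_nonneg) auto
  qed
  \<comment> \<open>completing the square; the terms with \<open>D\<close> cancel, which is the role of the stability inequality\<close>
  also have "\<dots> = r * b r * P + 2 * K * r\<^sup>2 * P + (G * (F r - (1 + r * b r) * g r + g r * s r)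
    + g r * (- (r\<^sup>2 * D r * g r) - ((r * b r + r\<^sup>2 * b' r) * g r + (1 + r * b r) * G) + G * s r)
    + (g r)\<^sup>2 * (- (r * b r) * s r + (s r)\<^sup>2 + r\<^sup>2 * D r))"
    unfolding P_def G_def by (simp only: power2_eq_square) algebra
  also have "\<dots> \<le> r * b r * P + 2 * K * r\<^sup>2 * P + r * P'"
    unfolding rP' using s(2) by (intro add_left_mono mult_left_mono) auto
  also have "\<dots> = r * ((b r + 2 * K * r) * P + P')" by (simp add: algebra_simps power2_eq_square)
  finally have "0 \<le> (b r + 2 * K * r) * P + P'" using r by (simp add: zero_le_mult_iff)
  then have "0 \<le> ?A * ((b r + 2 * K * r) * P + P')" using a(2) by simp
  then have "0 \<le> ?A * (b r + 2 * K * r) * P + P' * ?A" by (simp add: algebra_simps)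
  with D show ?thesis by blast
qed

context radial_weight
begin

lemma weight_bounds:
  obtains \<alpha> A where "0 < \<alpha>" "\<And>r. r \<in> {0..1} \<Longrightarrow> \<alpha> \<le> a r" "\<And>r. r \<in> {0..1} \<Longrightarrow> a r \<le> A"
proof -
  have ne: "{0..1::real} \<noteq> {}" by simp
  obtain x where x: "x \<in> {0..1}" "\<And>y. y \<in> {0..1} \<Longrightarrow> a x \<le> a y"
    using continuous_attains_inf[OF compact_Icc ne a_cont] by blast
  obtain z where "z \<in> {0..1}" "\<And>y. y \<in> {0..1} \<Longrightarrow> a y \<le> a z"
    using continuous_attains_sup[OF compact_Icc ne a_cont] by blast
  with x that[of "a x" "a z"] a_pos[of x] show ?thesis by blast
qed

lemma flux_lower:
  assumes h: "continuous_on {0..1} h" and r: "r \<in> {0..1}" and m: "0 \<le> m"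
    and le: "\<And>t. t \<in> {0..r} \<Longrightarrow> m \<le> h t"
    and \<alpha>: "0 < \<alpha>" "\<And>t. t \<in> {0..1} \<Longrightarrow> \<alpha> \<le> a t"
  shows "m * \<alpha> * r\<^sup>2 / 2 \<le> flux h r"
proof -
  have I: "((\<lambda>t. m * \<alpha> * t) has_integral m * \<alpha> * (r\<^sup>2 / 2)) {0..r}"
    using has_integral_mult_right[OF ident_has_integral[of 0 r], of "m * \<alpha>"] r by simp
  have "m * \<alpha> * (r\<^sup>2 / 2) \<le> flux h r"
    unfolding flux_def
  proof (rule has_integral_le[OF I integrable_integral[OF flux_integrable[OF h]]])
    show "m * \<alpha> * t \<le> t * a t * h t" if t: "t \<in> {0..r}" for t
    proof -
      have "\<alpha> * m \<le> a t * h t"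
        using t r le[OF t] \<alpha>(2)[of t] \<alpha>(1) m by (intro mult_mono) auto
      from mult_left_mono[OF this, of t] show ?thesis using t by (simp add: mult_ac)
    qed
  qed (use r in auto)
  then show ?thesis by simp
qed

lemma slope_nonneg:
  assumes "continuous_on {0..1} h" "\<And>t. t \<in> {0..1} \<Longrightarrow> 0 \<le> h t" "r \<in> {0..1}"
  shows "0 \<le> slope h r"
  using flux_le_flux[OF assms(1,2), of 0 r] assms a_pos[of r] by (auto simp: slope_def)

lemma potential_antimono:
  assumes h: "continuous_on {0..1} h" "\<And>t. t \<in> {0..1} \<Longrightarrow> 0 \<le> h t"
    and "0 \<le> r" "r \<le> s" "s \<le> 1"
  shows "potential h s \<le> potential h r"
  unfolding potential_def
proof (rule integral_subset_le)
  show "\<forall>t\<in>{r..1}. 0 \<le> t * slope h t"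
    using slope_nonneg[OF h] assms by auto
qed (use assms potential_integrable in auto)

text \<open>
  Beyond \<open>r\<close> the flux only increases, so a potential that is bounded at \<open>r\<close> bounds the flux there. This turns
  \<open>u \<le> 1\<close> into a bound on \<open>u'\<close>, and bounds \<open>- v' / v\<close> for the difference of two solutions.
\<close>
lemma potential_lower:
  assumes h: "continuous_on {0..1} h" "\<And>t. t \<in> {0..1} \<Longrightarrow> 0 \<le> h t"
    and r: "0 < r" "r \<le> 1" and A: "\<And>t. t \<in> {0..1} \<Longrightarrow> a t \<le> A"
  shows "flux h r / A * (1 - r) \<le> potential h r"
proof -
  have A0: "0 < A" using A[of 0] a_pos[of 0] by simp
  have I: "((\<lambda>_. flux h r / A) has_integral flux h r / A * (1 - r)) {r..1}"
    using has_integral_const_real[of "flux h r / A" r 1] r by (simp add: mult.commute)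
  show ?thesis
    unfolding potential_def
  proof (rule has_integral_le[OF I integrable_integral[OF potential_integrable[OF h(1)]]])
    show "flux h r / A \<le> s * slope h s" if s: "s \<in> {r..1}" for s
    proof -
      have "0 \<le> flux h r" using flux_le_flux[OF h, of 0 r] r by simp
      moreover have "flux h r \<le> flux h s" using flux_le_flux[OF h, of r s] s r by simp
      moreover have "s * a s \<le> 1 * A"
        using A[of s] a_pos[of s] s r by (intro mult_mono) auto
      moreover have "0 < s * a s" using s r a_pos[of s] by simp
      ultimately have "flux h r / A \<le> flux h s / (s * a s)"
        by (intro frac_le) auto
      also have "\<dots> = s * slope h s" using s r by (simp add: slope_def power2_eq_square)
      finally show ?thesis .
    qed
  qed (use r in auto)
qed

lemma potential_pos:
  assumes h: "continuous_on {0..1} h" "\<And>t. t \<in> {0..1} \<Longrightarrow> 0 < h t"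
    and r: "0 \<le> r" "r < 1"
  shows "0 < potential h r"
proof -
  have h0: "\<And>t. t \<in> {0..1} \<Longrightarrow> 0 \<le> h t" using h(2) by (simp add: less_imp_le)
  have "{0..1::real} \<noteq> {}" by simp
  then obtain x where x: "x \<in> {0..1}" "\<And>y. y \<in> {0..1} \<Longrightarrow> h x \<le> h y"
    using continuous_attains_inf[OF compact_Icc _ h(1)] by blast
  obtain \<alpha> A where \<alpha>: "0 < \<alpha>" "\<And>r. r \<in> {0..1} \<Longrightarrow> \<alpha> \<le> a r" and A: "\<And>r. r \<in> {0..1} \<Longrightarrow> a r \<le> A"
    using weight_bounds by blast
  define s where "s = (r + 1) / 2"
  have s: "0 < s" "s < 1" "r \<le> s" using r by (auto simp: s_def)
  have "0 < h x * \<alpha> * s\<^sup>2 / 2" using h(2)[OF x(1)] \<alpha>(1) s by simp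
  also have "\<dots> \<le> flux h s"
    using flux_lower[OF h(1) _ _ _ \<alpha>, of s "h x"] x s h0[OF x(1)] by auto
  finally have "0 < flux h s / A * (1 - s)"
    using A[of 0] a_pos[of 0] s by simp
  also have "\<dots> \<le> potential h s" using potential_lower[OF h(1) h0 s(1) _ A] s by simp
  also have "\<dots> \<le> potential h r" using potential_antimono[OF h(1) h0 r(1) s(3)] s by simp
  finally show ?thesis .
qed

end

locale radial_problem = radial_weight +
  fixes f f' :: "real \<Rightarrow> real"
  assumes f_pos: "\<And>t. t \<in> {0..<1} \<Longrightarrow> 0 < f t"
    and f_mono: "mono_on {0..<1} f"
    and f_deriv: "\<And>t. t \<in> {0..<1} \<Longrightarrow> (f has_real_derivative f' t) (at t within {0..<1})"
    and f_convex: "convex_on {0..<1} f"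
begin

definition radial_solution :: "real \<Rightarrow> (real \<Rightarrow> real) \<Rightarrow> bool" where
  "radial_solution lam v \<longleftrightarrow> continuous_on {0..1} v \<and> (\<forall>r\<in>{0..1}. 0 \<le> v r \<and> v r < 1) \<and>
     (\<forall>r\<in>{0..1}. v r = potential (\<lambda>t. lam * f (v t)) r)"

lemma f_cont: "continuous_on {0..<1} f"
  using f_deriv by (meson DERIV_continuous continuous_on_eq_continuous_within)

lemma source_cont:
  assumes "continuous_on {0..1} v" "\<And>r. r \<in> {0..1} \<Longrightarrow> v r \<in> {0..<1}"
  shows "continuous_on {0..1} (\<lambda>t. lam * f (v t))"
  using assms by (intro continuous_intros continuous_on_compose2[OF f_cont]) auto

lemma f_tangent:
  assumes "0 < x" "x < 1" "y \<in> {0..<1}"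
  shows "f' x * (y - x) \<le> f y - f x"
proof (rule convex_on_imp_above_tangent[OF f_convex])
  show "connected {0..<1::real}" by (simp add: connected_iff_interval)
  show "x \<in> interior {0..<1}" using assms by simp
  show "(f has_real_derivative f' x) (at x within {0..<1})" using f_deriv assms by simp
qed (use assms in auto)

lemma radial_solutionD:
  assumes "radial_solution lam v"
  shows "continuous_on {0..1} v" "\<And>r. r \<in> {0..1} \<Longrightarrow> v r \<in> {0..<1}"
    and "\<And>r. r \<in> {0..1} \<Longrightarrow> v r = potential (\<lambda>t. lam * f (v t)) r"
    and "continuous_on {0..1} (\<lambda>t. lam * f (v t))"
proof -
  show c: "continuous_on {0..1} v" and r: "\<And>r. r \<in> {0..1} \<Longrightarrow> v r \<in> {0..<1}"
    and "\<And>r. r \<in> {0..1} \<Longrightarrow> v r = potential (\<lambda>t. lam * f (v t)) r"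
    using assms unfolding radial_solution_def atLeastLessThan_iff by blast+
  show "continuous_on {0..1} (\<lambda>t. lam * f (v t))" by (rule source_cont[OF c r])
qed

lemma radial_solution_antimono:
  assumes "0 < lam" "radial_solution lam v" "0 \<le> r" "r \<le> s" "s \<le> 1"
  shows "v s \<le> v r"
  using potential_antimono[OF radial_solutionD(4)[OF assms(2)], of r s]
    radial_solutionD(2,3)[OF assms(2)] f_pos assms by (simp add: less_imp_le)

lemma radial_solution_pos:
  assumes "0 < lam" "radial_solution lam v" "0 \<le> r" "r < 1"
  shows "0 < v r"
  using potential_pos[OF radial_solutionD(4)[OF assms(2)], of r]
    radial_solutionD(2,3)[OF assms(2)] f_pos assms by simp

text \<open>
  The two solutions enter through \<open>v = w - u\<close>, the positive supersolution that expresses stability of \<open>u\<close>.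
  The energy is evaluated at the centre, where it is \<open>a(0) F(0)^2 / 4\<close>, and at
  the radius \<open>R\<close>, where \<open>g\<close>, \<open>F\<close> and \<open>s\<close> are bounded by constants that depend on \<open>a\<close> and \<open>R\<close> alone.
\<close>
lemma center_bound:
  assumes b': "\<And>r. r \<in> {0<..<1} \<Longrightarrow> (b has_real_derivative b' r) (at r)"
    "\<And>r. r \<in> {0<..<1} \<Longrightarrow> b' r \<le> B"
  obtains C where "\<And>mu lam u w. 0 < mu \<Longrightarrow> mu < lam \<Longrightarrow> radial_solution mu u \<Longrightarrow>
    radial_solution lam w \<Longrightarrow> (\<And>r. r \<in> {0..1} \<Longrightarrow> u r \<le> w r) \<Longrightarrow> mu * f (u 0) \<le> C"
proof -
  \<comment> \<open>\<open>K \<ge> B\<close> makes the energy monotone up to \<open>R = 1 / sqrt K\<close>; \<open>K \<ge> 4\<close> keeps \<open>R \<le> 1 / 2\<close> inside the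
    interval\<close>
  define K where "K = max B 4"
  define R where "R = 1 / sqrt K"
  have K: "4 \<le> K" "B \<le> K" by (auto simp: K_def)
  have KR: "K * R\<^sup>2 = 1" using K by (simp add: R_def power_divide)
  have "2 \<le> sqrt K" using K real_le_rsqrt[of 2 K] by simp
  then have R: "0 < R" "R < 1" using K by (auto simp: R_def divide_less_eq)
  obtain \<alpha> A where \<alpha>: "0 < \<alpha>" "\<And>r. r \<in> {0..1} \<Longrightarrow> \<alpha> \<le> a r" and A: "\<And>r. r \<in> {0..1} \<Longrightarrow> a r \<le> A"
    using weight_bounds by blast
  have A0: "0 < A" using A[of 0] a_pos[of 0] by simp
  define g1 where "g1 = A / (1 - R) / (R\<^sup>2 * \<alpha>)"
  define s1 where "s1 = A / (1 - R) / \<alpha>"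
  have g1: "0 < g1" and s1: "0 < s1" using A0 \<alpha> R by (auto simp: g1_def s1_def)
  define C where "C = A * exp (K * R\<^sup>2) * (g1 * (2 * g1 + \<bar>R * b R\<bar> * g1 + g1 * s1))"
  show ?thesis
  proof (rule that[of "4 * C / \<alpha> + 1"])
    fix mu lam u w
    assume mu: "0 < mu" "mu < lam" and u: "radial_solution mu u" and w: "radial_solution lam w"
      and uw: "\<And>r. r \<in> {0..1} \<Longrightarrow> u r \<le> w r"
    define F where "F = (\<lambda>t. mu * f (u t))"
    define H where "H = (\<lambda>t. lam * f (w t) - F t)"
    define g where "g = slope F"
    define v where "v = potential H"
    define s where "s = (\<lambda>r. r\<^sup>2 * slope H r / v r)"
    define E where "E = (\<lambda>r. a r * exp (K * r\<^sup>2) * (g r * (F r - (1 + r * b r) * g r + g r * s r)))"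
    note uD = radial_solutionD[OF u] and wD = radial_solutionD[OF w]
    have Fc: "continuous_on {0..1} F" unfolding F_def by (rule uD(4))
    have Hc: "continuous_on {0..1} H" unfolding H_def using wD(4) Fc by (rule continuous_on_diff)
    have Fpos: "0 < F t" if "t \<in> {0..1}" for t
      using mu f_pos[OF uD(2)[OF that]] by (simp add: F_def)
    have H_lower: "mu * (f (w t) - f (u t)) < H t" if "t \<in> {0..1}" for t
      using mu f_pos[OF wD(2)[OF that]] by (simp add: H_def F_def algebra_simps)
    have Hpos: "0 < H t" if t: "t \<in> {0..1}" for t
    proof -
      have "f (u t) \<le> f (w t)" using f_mono uD(2)[OF t] wD(2)[OF t] uw[OF t] by (rule mono_onD)
      then have "0 \<le> mu * (f (w t) - f (u t))" using mu by simp
      then show ?thesis using H_lower[OF t] by simp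
    qed
    have v: "v r = w r - u r" if "r \<in> {0..1}" for r
      unfolding v_def H_def using potential_diff[OF wD(4) Fc that] uD(3)[OF that] wD(3)[OF that]
      by (simp add: F_def)
    have vpos: "0 < v r" if "0 \<le> r" "r < 1" for r
      unfolding v_def by (rule potential_pos[OF Hc Hpos that])
    have E_mono: "E 0 \<le> E R"
    proof (rule DERIV_nonneg_imp_increasing_open[of 0 R E])
      have sub: "{0..R} \<subseteq> {0..1}" using R by auto
      note cs = continuous_on_subset[OF _ sub]
      have "continuous_on {0..R} s"
        unfolding s_def v_def
        using vpos R by (intro continuous_intros cs[OF slope_cont[OF Hc]] cs[OF potential_cont[OF Hc]])
          (auto simp: v_def less_imp_neq[symmetric])
      moreover have "continuous_on {0..R} g" unfolding g_def by (rule cs[OF slope_cont[OF Fc]])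
      ultimately show "continuous_on {0..R} E"
        unfolding E_def by (intro continuous_intros cs[OF a_cont] cs[OF b_cont] cs[OF Fc])
    next
      fix r assume r: "0 < r" "r < R"
      then have r1: "r \<in> {0<..<1}" "r \<in> {0..1}" using R by auto
      have at: "at r within {0..1} = at r" using r1 by (simp add: at_within_Icc_at)
      define D where "D = (\<lambda>r. mu * f' (u r))"
      have ur: "0 < u r" "u r < 1"
        using radial_solution_pos[OF mu(1) u, of r] uD(2)[of r] r1 by auto
      have du: "(u has_real_derivative - (r * g r)) (at r)"
      proof (rule has_field_derivative_transform_within_open[of "potential F" _ _ "{0<..<1}"])
        show "(potential F has_real_derivative - (r * g r)) (at r)"
          using potential_deriv[OF Fc r1(2)] by (simp add: at g_def)
      qed (use r1 uD(3) in \<open>auto simp: F_def\<close>)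
      have df: "(f has_real_derivative f' (u r)) (at (u r))"
      proof -
        have "at (u r) within {0..<1} = at (u r)" using ur by (intro at_within_interior) simp
        then show ?thesis using f_deriv[of "u r"] ur by simp
      qed
      have dF: "(F has_real_derivative - (r * D r * g r)) (at r)"
        using DERIV_cmult[OF DERIV_chain2[OF df du], of mu] by (simp add: F_def D_def mult_ac)
      have vr: "0 < v r" using vpos r1 by simp
      \<comment> \<open>the derivative of \<open>s\<close> as the quotient rule yields it\<close>
      define s' where "s' = ((2 * r * slope H r + r\<^sup>2 * ((H r - (2 + r * b r) * slope H r) / r)) * v r
        + r\<^sup>2 * slope H r * (r * slope H r)) / (v r * v r)"
      have dG: "((\<lambda>r. r\<^sup>2 * slope H r) has_real_derivative
          2 * r * slope H r + r\<^sup>2 * ((H r - (2 + r * b r) * slope H r) / r)) (at r)"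
        by (rule derivative_eq_intros slope_deriv[OF Hc r1(1)] refl)+ simp
      have dv: "(v has_real_derivative - (r * slope H r)) (at r)"
        using potential_deriv[OF Hc r1(2)] by (simp add: at v_def)
      have ds: "(s has_real_derivative s') (at r)"
        unfolding s_def s'_def using DERIV_divide[OF dG dv] vr by simp
      \<comment> \<open>convexity: the difference of two ordered solutions is a supersolution of the linearised equation\<close>
      have "mu * (f' (u r) * (w r - u r)) \<le> mu * (f (w r) - f (u r))"
        using f_tangent[OF ur wD(2)[OF r1(2)]] mu by (intro mult_left_mono) auto
      then have "D r * v r \<le> H r" using H_lower[OF r1(2)] v[OF r1(2)] by (simp add: D_def mult_ac)
      then have "r\<^sup>2 * D r \<le> r\<^sup>2 * H r / v r"
        using vr mult_left_mono[of "D r * v r" "H r" "r\<^sup>2"] by (simp add: pos_le_divide_eq mult_ac)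
      moreover have "r * s' = - (r * b r) * s r + (s r)\<^sup>2 + r\<^sup>2 * H r / v r"
        unfolding s'_def s_def using vr r by (simp add: field_simps power2_eq_square)
      ultimately have rs': "- (r * b r) * s r + (s r)\<^sup>2 + r\<^sup>2 * D r \<le> r * s'" by simp
      have "r\<^sup>2 \<le> R\<^sup>2" using r by (intro power_mono) auto
      then have Kr: "K * r\<^sup>2 \<le> 1" using KR K mult_left_mono[of "r\<^sup>2" "R\<^sup>2" K] by simp
      have bK: "b' r \<le> K" using b'(2)[OF r1(1)] K by simp
      show "\<exists>y. (E has_real_derivative y) (at r) \<and> 0 \<le> y"
        unfolding E_def
        by (rule energy_deriv[where a=a and b=b and b'=b' and K=K and g=g and F=F and D=D and s=s, OF r(1) a_deriv[OF r1(1)] a_pos[OF r1(2)] b'(1)[OF r1(1)] bK _ Kr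
              slope_deriv[OF Fc r1(1), folded g_def] dF ds rs']) (use K in simp)
    qed (use R in simp)
    have RR: "R \<in> {0..1}" using R by simp
    have aR: "\<alpha> \<le> a R" "a R \<le> A" "0 < a R" using \<alpha> A a_pos RR by auto
    have Fnn: "\<And>t. t \<in> {0..1} \<Longrightarrow> 0 \<le> F t" using Fpos by (simp add: less_imp_le)
    have Hnn: "\<And>t. t \<in> {0..1} \<Longrightarrow> 0 \<le> H t" using Hpos by (simp add: less_imp_le)
    \<comment> \<open>from here on: bounds at \<open>R\<close> that do not depend on \<open>\<mu>\<close>, \<open>\<lambda>\<close>, \<open>u\<close>, \<open>w\<close>\<close>
    have fluxF: "flux F R \<le> A / (1 - R)"
    proof -
      have "flux F R / A * (1 - R) \<le> potential F R" using potential_lower[OF Fc Fnn R(1) _ A] R by simp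
      also have "\<dots> \<le> 1" using uD(2,3)[OF RR] by (simp add: F_def)
      finally show ?thesis using A0 R by (simp add: field_simps)
    qed
    have FR0: "0 \<le> flux F R" using flux_le_flux[OF Fc Fnn, of 0 R] R by simp
    have gR: "g R \<le> g1" "0 \<le> g R"
    proof -
      show "g R \<le> g1"
      proof -
        have "flux F R / (R\<^sup>2 * a R) \<le> A / (1 - R) / (R\<^sup>2 * \<alpha>)"
          by (rule frac_le) (use R fluxF FR0 aR \<alpha>(1) in auto)
        then show ?thesis unfolding g_def g1_def slope_def using R by simp
      qed
      show "0 \<le> g R" unfolding g_def by (rule slope_nonneg[OF Fc Fnn RR])
    qed
    have FR: "F R \<le> 2 * g1"
    proof -
      \<comment> \<open>\<open>F\<close> decreases with the radius, so its value at \<open>R\<close> is controlled by its weighted mean, the flux\<close>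
      have "F R \<le> F t" if "t \<in> {0..R}" for t
      proof -
        have "u R \<le> u t" using radial_solution_antimono[OF mu(1) u, of t R] that R by simp
        then have "f (u R) \<le> f (u t)"
          using f_mono uD(2)[of R] uD(2)[of t] that R by (auto elim!: mono_onD)
        then show ?thesis using mu by (simp add: F_def)
      qed
      from flux_lower[OF Fc RR Fnn[OF RR] this \<alpha>] fluxF
      have "F R * \<alpha> * R\<^sup>2 \<le> 2 * (A / (1 - R))" by linarith
      then have "F R * (\<alpha> * R\<^sup>2) \<le> 2 * (A / (1 - R))" by (simp only: mult.assoc)
      then have "F R \<le> 2 * (A / (1 - R)) / (\<alpha> * R\<^sup>2)"
        using \<alpha>(1) R by (subst pos_le_divide_eq) auto
      then show ?thesis by (simp add: g1_def mult_ac)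
    qed
    have vR: "0 < v R" using vpos R by simp
    have sR: "0 \<le> s R" "s R \<le> s1"
    proof -
      show "0 \<le> s R" unfolding s_def using slope_nonneg[OF Hc Hnn RR] vR by simp
      have "flux H R / A * (1 - R) \<le> v R"
        unfolding v_def using potential_lower[OF Hc Hnn R(1) _ A] R by simp
      then have "flux H R \<le> A / (1 - R) * v R" using A0 R by (simp add: field_simps)
      then have "flux H R \<le> s1 * \<alpha> * v R" using \<alpha>(1) by (simp add: s1_def)
      also have "\<dots> \<le> s1 * a R * v R" using aR s1 vR by (intro mult_right_mono mult_left_mono) auto
      finally have "flux H R / (a R * v R) \<le> s1"
        using aR vR by (simp add: pos_divide_le_eq mult_ac)
      then show "s R \<le> s1" unfolding s_def slope_def using R by (simp add: field_simps)
    qed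
    have "E R \<le> C"
    proof -
      have "- (R * b R) * g R \<le> \<bar>R * b R\<bar> * g1"
        using gR by (meson abs_ge_minus_self abs_ge_zero mult_mono)
      moreover have "g R * s R \<le> g1 * s1" using gR sR g1 by (intro mult_mono) auto
      ultimately have 1: "F R - (1 + R * b R) * g R + g R * s R \<le> 2 * g1 + \<bar>R * b R\<bar> * g1 + g1 * s1"
        using FR gR by (simp add: algebra_simps)
      have "g R * (F R - (1 + R * b R) * g R + g R * s R) \<le> g R * (2 * g1 + \<bar>R * b R\<bar> * g1 + g1 * s1)"
        using 1 gR(2) by (rule mult_left_mono)
      also have "\<dots> \<le> g1 * (2 * g1 + \<bar>R * b R\<bar> * g1 + g1 * s1)"
        using gR g1 s1 by (intro mult_right_mono) auto
      finally have "E R \<le> a R * exp (K * R\<^sup>2) * (g1 * (2 * g1 + \<bar>R * b R\<bar> * g1 + g1 * s1))"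
        unfolding E_def using aR by (intro mult_left_mono) auto
      also have "\<dots> \<le> C" unfolding C_def using aR g1 s1 by (intro mult_right_mono) auto
      finally show ?thesis .
    qed
    moreover have "E 0 = a 0 * (F 0)\<^sup>2 / 4"
      by (simp add: E_def g_def s_def power2_eq_square)
    moreover have "\<alpha> * (F 0)\<^sup>2 / 4 \<le> a 0 * (F 0)\<^sup>2 / 4"
      using \<alpha>(2)[of 0] by (intro divide_right_mono mult_right_mono) auto
    ultimately have "\<alpha> * (F 0)\<^sup>2 / 4 \<le> C" using E_mono by linarith
    then have "(F 0)\<^sup>2 \<le> 4 * C / \<alpha>" using \<alpha>(1) by (simp add: field_simps)
    moreover have "F 0 \<le> (F 0)\<^sup>2 + 1"
      using sum_squares_bound[of "F 0" 1] Fpos[of 0] by simp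
    ultimately show "mu * f (u 0) \<le> 4 * C / \<alpha> + 1" by (simp add: F_def)
  qed
qed

end

section \<open>Limits and monotone iteration\<close>

lemma norm_axis_scaled: "r \<in> {0..1} \<Longrightarrow> norm (r *\<^sub>R axis i (1::real) :: real ^ 'n) = r"
  by (simp add: norm_axis_1)

context radial_problem
begin

text \<open>
  Stated for iterates \<open>v n\<close> whose potentials have the same limit, so that it covers both the iteration
  \<open>v (n + 1) = potential (l f(v n))\<close> with fixed parameter and exact solutions with varying parameter. A bound
  \<open>m < 1\<close> keeps \<open>f\<close> bounded; the limit is continuous because the potentials are uniformly Lipschitz.
\<close>
lemma radial_solution_limit:
  assumes vc: "\<And>n. continuous_on {0..1} (v n)"
    and v: "\<And>n r. r \<in> {0..1} \<Longrightarrow> 0 \<le> v n r \<and> v n r \<le> m" and m: "m < 1"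
    and lam: "\<And>n. 0 \<le> l n \<and> l n \<le> \<Lambda>" "l \<longlonglongrightarrow> lam"
    and vw: "\<And>r. r \<in> {0..1} \<Longrightarrow> (\<lambda>n. v n r) \<longlonglongrightarrow> w r"
    and pw: "\<And>r. r \<in> {0..1} \<Longrightarrow> (\<lambda>n. potential (\<lambda>t. l n * f (v n t)) r) \<longlonglongrightarrow> w r"
  shows "radial_solution lam w"
proof -
  have m0: "0 \<le> m" using v[of 0] by force
  have v1: "v n r \<in> {0..<1}" if "r \<in> {0..1}" for n r using v[OF that, of n] m by auto
  have hc: "continuous_on {0..1} (\<lambda>t. l n * f (v n t))" for n
    by (rule source_cont[OF vc v1])
  have hM: "\<bar>l n * f (v n t)\<bar> \<le> \<Lambda> * f m" if t: "t \<in> {0..1}" for n t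
  proof -
    have "f (v n t) \<le> f m" by (rule mono_onD[OF f_mono v1[OF t]]) (use m m0 v[OF t] in auto)
    then show ?thesis
      using lam(1)[of n] f_pos[OF v1[OF t], of n] f_pos[of m] m m0
      by (auto simp: abs_mult intro!: mult_mono)
  qed
  have w: "0 \<le> w r" "w r \<le> m" if "r \<in> {0..1}" for r
    using v[OF that] vw[OF that] by (auto intro: LIMSEQ_le_const LIMSEQ_le_const2)
  obtain C where C: "C > 0"
    "\<And>h M r. continuous_on {0..1} h \<Longrightarrow> (\<And>t. t \<in> {0..1} \<Longrightarrow> \<bar>h t\<bar> \<le> M) \<Longrightarrow> r \<in> {0..1}
      \<Longrightarrow> \<bar>slope h r\<bar> \<le> C * M"
    using slope_bound by blast
  define L where "L = C * (\<Lambda> * f m)"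
  have "\<bar>w r - w s\<bar> \<le> L * \<bar>r - s\<bar>" if rs: "r \<in> {0..1}" "s \<in> {0..1}" for r s
  proof -
    let ?p = "\<lambda>n. potential (\<lambda>t. l n * f (v n t))"
    have "\<bar>?p n r - ?p n s\<bar> \<le> L * \<bar>r - s\<bar>" for n
      unfolding L_def by (rule potential_lipschitz[OF hc C(2)[OF hc hM] rs])
    moreover have "(\<lambda>n. \<bar>?p n r - ?p n s\<bar>) \<longlonglongrightarrow> \<bar>w r - w s\<bar>"
      by (intro tendsto_intros pw rs)
    ultimately show ?thesis by (intro LIMSEQ_le_const2) auto
  qed
  then have "\<forall>r\<in>{0..1}. \<forall>s\<in>{0..1}. dist (w r) (w s) \<le> L * dist r s" by (simp add: dist_real_def)
  moreover have "0 \<le> L" using C(1) lam(1)[of 0] f_pos[of m] m m0 by (simp add: L_def)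
  ultimately have wc: "continuous_on {0..1} w"
    by (intro lipschitz_on_continuous_on[of L] lipschitz_onI) auto
  have w1: "w r \<in> {0..<1}" if "r \<in> {0..1}" for r using w[OF that] m by auto
  have hw: "continuous_on {0..1} (\<lambda>t. lam * f (w t))" by (rule source_cont[OF wc w1])
  have "(\<lambda>n. potential (\<lambda>t. l n * f (v n t)) r) \<longlonglongrightarrow> potential (\<lambda>t. lam * f (w t)) r"
    if r: "r \<in> {0..1}" for r
  proof (rule potential_tendsto[OF hc hw hM _ r])
    fix t :: real assume t: "t \<in> {0..1}"
    have "(\<lambda>n. f (v n t)) \<longlonglongrightarrow> f (w t)"
      by (rule continuous_on_tendsto_compose[OF f_cont vw[OF t] w1[OF t]])
        (intro always_eventually allI v1[OF t])
    then show "(\<lambda>n. l n * f (v n t)) \<longlonglongrightarrow> lam * f (w t)" by (intro tendsto_intros lam)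
  qed
  then have "w r = potential (\<lambda>t. lam * f (w t)) r" if "r \<in> {0..1}" for r
    using pw[OF that] that LIMSEQ_unique by blast
  then show ?thesis unfolding radial_solution_def using wc w1 by auto
qed

text \<open>
  The iterates from \<open>0\<close> increase, and the barrier \<open>U\<close>, preserved by each step, keeps them away from \<open>1\<close>. The
  barrier is a function on the disc, because it will be a regular solution not yet known to be radial.
\<close>
lemma radial_solution_below:
  fixes U :: "real ^ 2 \<Rightarrow> real"
  assumes lam: "0 < lam" and m: "m < 1"
    and U: "\<And>x. x \<in> cball 0 1 \<Longrightarrow> 0 \<le> U x \<and> U x \<le> m"
    and inv: "\<And>w x. continuous_on {0..1} w \<Longrightarrow> (\<And>r. r \<in> {0..1} \<Longrightarrow> 0 \<le> w r) \<Longrightarrow>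
      (\<And>x. x \<in> cball 0 1 \<Longrightarrow> w (norm x) \<le> U x) \<Longrightarrow> x \<in> cball 0 1 \<Longrightarrow>
      potential (\<lambda>t. lam * f (w t)) (norm x) \<le> U x"
  obtains w where "radial_solution lam w" "\<And>x. x \<in> cball 0 1 \<Longrightarrow> w (norm x) \<le> U x"
proof -
  let ?T = "\<lambda>w. potential (\<lambda>t. lam * f (w t))"
  define w where "w n = (?T ^^ n) (\<lambda>_. 0)" for n
  have w0: "w 0 = (\<lambda>_. 0)" and wS: "w (Suc n) = ?T (w n)" for n by (simp_all add: w_def)
  \<comment> \<open>every radius is attained on the first coordinate axis\<close>
  have leU: "v r \<le> m" if "\<And>x. x \<in> cball 0 1 \<Longrightarrow> v (norm x) \<le> U x" "r \<in> {0..1}" for v r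
  proof -
    have "r *\<^sub>R axis 1 1 \<in> cball (0::real^2) 1" using norm_axis_scaled[OF that(2)] that(2) by simp
    from that(1)[OF this] U[OF this] show ?thesis using norm_axis_scaled[OF that(2)] by auto
  qed
  have P: "continuous_on {0..1} (w n) \<and> (\<forall>r\<in>{0..1}. 0 \<le> w n r) \<and> (\<forall>x\<in>cball 0 1. w n (norm x) \<le> U x)" for n
  proof (induction n)
    case 0
    then show ?case using U by (simp add: w0)
  next
    case (Suc n)
    then have c: "continuous_on {0..1} (w n)" and p: "\<And>r. r \<in> {0..1} \<Longrightarrow> 0 \<le> w n r"
      and le: "\<And>x. x \<in> cball 0 1 \<Longrightarrow> w n (norm x) \<le> U x" by auto
    have 1: "w n r \<in> {0..<1}" if "r \<in> {0..1}" for r using p[OF that] leU[of "w n", OF le that] m by auto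
    have hc: "continuous_on {0..1} (\<lambda>t. lam * f (w n t))" by (rule source_cont[OF c 1])
    have "0 \<le> ?T (w n) r" if "r \<in> {0..1}" for r
      using potential_antimono[OF hc, of r 1] that lam f_pos[OF 1] by (simp add: less_imp_le)
    then show ?case unfolding wS using potential_cont[OF hc] inv[OF c p le] by blast
  qed
  have w1: "0 \<le> w n r \<and> w n r \<le> m" if "r \<in> {0..1}" for n r
    using P[of n] that leU[of "w n" r] by auto
  have w2: "w n r \<in> {0..<1}" if "r \<in> {0..1}" for n r using w1[OF that, of n] m by auto
  have wc: "continuous_on {0..1} (w n)" for n using P by blast
  have mono: "\<forall>r\<in>{0..1}. w n r \<le> w (Suc n) r" for n
  proof (induction n)
    case 0
    then show ?case using P[of 1] by (simp add: w0)
  next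
    case (Suc n)
    show ?case
    proof
      fix r :: real assume r: "r \<in> {0..1}"
      have "?T (w n) r \<le> ?T (w (Suc n)) r"
      proof (rule potential_mono[OF source_cont[OF wc w2] source_cont[OF wc w2] r])
        fix t :: real assume t: "t \<in> {0..1}"
        have "f (w n t) \<le> f (w (Suc n) t)"
          using Suc t by (intro mono_onD[OF f_mono w2[OF t] w2[OF t]]) blast
        then show "lam * f (w n t) \<le> lam * f (w (Suc n) t)" using lam by simp
      qed
      then show "w (Suc n) r \<le> w (Suc (Suc n)) r" unfolding wS[symmetric] .
    qed
  qed
  define v where "v r = lim (\<lambda>n. w n r)" for r
  have lim: "(\<lambda>n. w n r) \<longlonglongrightarrow> v r" if r: "r \<in> {0..1}" for r
  proof -
    have "incseq (\<lambda>n. w n r)" using mono r by (intro incseq_SucI) blast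
    moreover have "Bseq (\<lambda>n. w n r)" using w1[OF r] by (intro BseqI'[of _ m]) auto
    ultimately have "convergent (\<lambda>n. w n r)" by (intro Bseq_monoseq_convergent incseq_imp_monoseq)
    then show ?thesis unfolding v_def by (simp add: convergent_LIMSEQ_iff)
  qed
  have "(\<lambda>n. ?T (w n) r) \<longlonglongrightarrow> v r" if "r \<in> {0..1}" for r
    using LIMSEQ_Suc[OF lim[OF that]] by (simp add: wS)
  then have "radial_solution lam v"
    using lam by (intro radial_solution_limit[OF wc w1 m _ tendsto_const lim]) auto
  moreover have "v (norm x) \<le> U x" if "x \<in> cball 0 1" for x
    using lim[of "norm x"] P that by (intro LIMSEQ_le_const2[OF lim]) auto
  ultimately show ?thesis using that by blast
qed

text \<open>
  The constant \<open>1/2\<close> is a barrier for small parameters.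
\<close>
lemma small_radial_solution:
  obtains lam w where "0 < lam" "radial_solution lam w"
proof -
  let ?Q = "potential (\<lambda>_. 1) 0"
  have f2: "0 < f (1/2)" by (rule f_pos) simp
  have Q: "0 < ?Q" by (rule potential_pos) auto
  define lam where "lam = 1 / (2 * f (1/2) * ?Q)"
  have lam: "0 < lam" using f2 Q by (simp add: lam_def)
  obtain w where "radial_solution lam w" "\<And>x::real^2. x \<in> cball 0 1 \<Longrightarrow> w (norm x) \<le> 1 / 2"
  proof (rule radial_solution_below[OF lam, of "1/2" "\<lambda>_. 1/2"])
    fix w :: "real \<Rightarrow> real" and x :: "real ^ 2"
    assume w: "continuous_on {0..1} w" "\<And>r. r \<in> {0..1} \<Longrightarrow> 0 \<le> w r"
      "\<And>x::real^2. x \<in> cball 0 1 \<Longrightarrow> w (norm x) \<le> 1 / 2" and x: "x \<in> cball 0 1"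
    have w2: "w r \<le> 1 / 2" if "r \<in> {0..1}" for r
      using w(3)[of "r *\<^sub>R axis 1 1"] norm_axis_scaled[OF that, where 'n=2] that by simp
    have w1: "w r \<in> {0..<1}" if "r \<in> {0..1}" for r using w2[OF that] w(2)[OF that] by simp
    have nx: "norm x \<in> {0..1}" using x by simp
    have "potential (\<lambda>t. lam * f (w t)) (norm x) \<le> potential (\<lambda>t. lam * f (1/2) * 1) (norm x)"
    proof (rule potential_mono[OF source_cont[OF w(1) w1] _ nx])
      show "lam * f (w t) \<le> lam * f (1/2) * 1" if "t \<in> {0..1}" for t
        using lam mono_onD[OF f_mono w1[OF that] _ w2[OF that]] by simp
    qed auto
    also have "\<dots> = lam * f (1/2) * potential (\<lambda>_. 1) (norm x)" by (rule potential_cmult)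
    also have "\<dots> \<le> lam * f (1/2) * ?Q"
      using lam f2 nx by (intro mult_left_mono potential_antimono) auto
    also have "\<dots> = 1 / 2" using f2 Q by (simp add: lam_def)
    finally show "potential (\<lambda>t. lam * f (w t)) (norm x) \<le> 1 / 2" .
  qed auto
  with lam that show ?thesis by blast
qed

text \<open>
  Since \<open>f \<ge> f(0)\<close>, a solution dominates \<open>\<lambda> f(0)\<close> times the torsion function, and solutions are below \<open>1\<close>.
\<close>
lemma radial_solution_parameter_bound:
  assumes "0 < lam" "radial_solution lam w"
  shows "lam \<le> 1 / (f 0 * potential (\<lambda>_. 1) 0)"
proof -
  note D = radial_solutionD[OF assms(2)]
  have Q: "0 < potential (\<lambda>_. 1) 0" by (rule potential_pos) auto
  have "potential (\<lambda>_. lam * f 0 * 1) 0 \<le> potential (\<lambda>t. lam * f (w t)) 0"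
  proof (rule potential_mono[OF _ D(4)])
    show "lam * f 0 * 1 \<le> lam * f (w t)" if "t \<in> {0..1}" for t
      using assms(1) D(2)[OF that] mono_onD[OF f_mono _ D(2)[OF that], of 0] by simp
  qed auto
  also have "\<dots> < 1" using D(2,3)[of 0] by simp
  finally have "lam * (f 0 * potential (\<lambda>_. 1) 0) \<le> 1" unfolding potential_cmult by (simp add: mult.assoc)
  then show ?thesis using Q f_pos[of 0] by (subst pos_le_divide_eq) auto
qed

end

section \<open>Radial advection fields\<close>

text \<open>
  The field is prescribed off the origin only: at the origin the gradient of a radial solution vanishes.
\<close>
locale radial_advection = radial_problem a b f f'
  for a b f f' :: "real \<Rightarrow> real" +
  fixes c :: "real ^ 2 \<Rightarrow> real ^ 2"
  assumes c: "\<And>x. x \<in> ball 0 1 \<Longrightarrow> x \<noteq> 0 \<Longrightarrow> c x = - (b (norm x) / norm x) *\<^sub>R x"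
begin

lemma regular_of_radial:
  assumes lam: "0 < lam" and w: "radial_solution lam w"
    and u: "\<And>x. x \<in> cball 0 1 \<Longrightarrow> u x = w (norm x)"
  shows "regular_solution (ball 0 1) c f lam u"
proof -
  note D = radial_solutionD[OF w]
  have up: "u x = potential (\<lambda>t. lam * f (w t)) (norm x)" if "x \<in> cball 0 1" for x
    using u[OF that] D(3)[of "norm x"] that by simp
  note S = potential_solves[OF D(4) c up]
  have "Ck_closure 2 (ball 0 1) u" by (rule S(1))
  moreover have "- laplacian u x + c x \<bullet> grad u x = lam * f (u x)" if "x \<in> ball 0 1" for x
    using S(2)[OF _ _ _ that] that u[of x] by simp
  moreover have "0 < u x" "u x < 1" if "x \<in> ball 0 1" for x
    using radial_solution_pos[OF lam w, of "norm x"] D(2)[of "norm x"] u[of x] that by auto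
  moreover have "u x = 0" if "x \<in> frontier (ball 0 1)" for x
    using up[of x] that by (simp add: frontier_ball)
  ultimately show ?thesis unfolding regular_solution_def by blast
qed

text \<open>
  Comparison of \<open>U\<close> with the potential of a smaller right-hand side. Adding the potential of a small constant
  \<open>d\<close> makes the differential inequality strict.
\<close>
lemma potential_below_regular:
  assumes mu: "0 < mu" "mu \<le> lam" and U: "regular_solution (ball 0 1) c f lam U"
    and wc: "continuous_on {0..1} w" and w0: "\<And>r. r \<in> {0..1} \<Longrightarrow> 0 \<le> w r"
    and w1: "\<And>r. r \<in> {0..1} \<Longrightarrow> w r < 1"
    and wU: "\<And>x. x \<in> cball 0 1 \<Longrightarrow> w (norm x) \<le> U x" and x: "x \<in> cball 0 1"
  shows "potential (\<lambda>t. mu * f (w t)) (norm x) \<le> U x"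
proof (rule field_le_epsilon)
  fix e :: real assume e: "0 < e"
  let ?h = "\<lambda>t. mu * f (w t)"
  let ?Q = "potential (\<lambda>_. 1) (norm x)"
  define d where "d = e / (\<bar>?Q\<bar> + 1)"
  have d: "0 < d" using e by (simp add: d_def)
  have w: "w r \<in> {0..<1}" if "r \<in> {0..1}" for r using w0[OF that] w1[OF that] by simp
  have hc: "continuous_on {0..1} ?h" by (rule source_cont[OF wc w])
  have one: "continuous_on {0..1} (\<lambda>_::real. 1::real)" by simp
  have dc: "continuous_on {0..1} (\<lambda>_::real. d * 1)" by simp
  define P where "P = (\<lambda>y::real^2. potential (\<lambda>t. d * 1 - ?h t) (norm y))"
  note S = potential_solves[OF continuous_on_diff[OF dc hc] c, of P]
  have UC: "Ck_closure 2 (ball 0 1) U" and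
    U1: "\<And>y. y \<in> ball 0 1 \<Longrightarrow> 0 < U y \<and> U y < 1 \<and> - laplacian U y + c y \<bullet> grad U y = lam * f (U y)"
    and Ub: "\<And>y. y \<in> frontier (ball 0 1) \<Longrightarrow> U y = 0"
    using U by (auto simp: regular_solution_def)
  have PC: "Ck_closure 2 (ball 0 1) P" by (rule S(1)) (simp_all add: P_def)
  have "0 \<le> U x + P x"
  proof (rule strict_minimum_principle[where \<Omega> = "ball 0 1" and z = "\<lambda>y. U y + P y" and c = c])
    show "continuous_on (closure (ball 0 1)) (\<lambda>y. U y + P y)"
      using UC PC by (auto simp: Ck_closure_def intro!: continuous_intros)
    show "0 \<le> U y + P y" if "y \<in> frontier (ball 0 1)" for y
      using Ub[OF that] that by (simp add: frontier_ball P_def)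
    fix y :: "real ^ 2" assume y: "y \<in> ball 0 1"
    note A = C2_add[OF open_ball y UC PC]
    show "(\<lambda>y. U y + P y) differentiable at y" by (rule A(1))
    show "partial i (\<lambda>y. U y + P y) differentiable at y" for i by (rule A(2))
    have "f (w (norm y)) \<le> f (U y)"
      using wU[of y] y U1[OF y] w[of "norm y"] by (intro mono_onD[OF f_mono]) auto
    then have "mu * f (w (norm y)) \<le> lam * f (U y)"
      using mu f_pos[of "U y"] U1[OF y] f_pos[OF w, of "norm y"] y by (intro mult_mono) auto
    moreover have "- laplacian P y + c y \<bullet> grad P y = d * 1 - ?h (norm y)"
      by (rule S(2)) (use y in \<open>simp_all add: P_def\<close>)
    moreover have "- laplacian U y + c y \<bullet> grad U y = lam * f (U y)" using U1[OF y] by blast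
    ultimately show "0 < - laplacian (\<lambda>y. U y + P y) y + c y \<bullet> grad (\<lambda>y. U y + P y) y"
      unfolding A(3,4) inner_add_right using d by linarith
  qed (use x in auto)
  moreover have "P x = d * ?Q - potential ?h (norm x)"
    using potential_diff[OF dc hc, of "norm x"] x by (simp add: P_def potential_cmult[of d "\<lambda>_. 1", simplified])
  moreover have "d * ?Q \<le> e"
  proof -
    have "d * ?Q \<le> d * (\<bar>?Q\<bar> + 1)" using d by (intro mult_left_mono) auto
    also have "\<dots> = e" by (simp add: d_def add_nonneg_eq_0_iff)
    finally show ?thesis .
  qed
  ultimately show "potential ?h (norm x) \<le> U x + e" by linarith
qed

text \<open>
  Applied with \<open>\<mu> = \<lambda>\<close> to a minimal solution, this shows that it is radial; with \<open>\<mu> < \<lambda>\<close>, that minimal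
  solutions increase with the parameter.
\<close>
lemma radial_below_regular:
  assumes mu: "0 < mu" "mu \<le> lam" and U: "regular_solution (ball 0 1) c f lam U"
  obtains w where "radial_solution mu w" "\<And>x. x \<in> cball 0 1 \<Longrightarrow> w (norm x) \<le> U x"
proof -
  have Uc: "continuous_on (cball 0 1) U" and U1: "\<And>x. x \<in> ball 0 1 \<Longrightarrow> 0 < U x \<and> U x < 1"
    and Ub: "\<And>x. x \<in> frontier (ball 0 1) \<Longrightarrow> U x = 0"
    using U by (auto simp: regular_solution_def Ck_closure_def)
  have U2: "0 \<le> U x \<and> U x < 1" if "x \<in> cball 0 1" for x
  proof (cases "norm x < 1")
    case True
    then show ?thesis using U1[of x] by simp
  next
    case False
    then show ?thesis using Ub[of x] that by (simp add: frontier_ball)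
  qed
  have "cball (0::real^2) 1 \<noteq> {}" by simp
  then obtain y where y: "y \<in> cball 0 1" "\<And>x. x \<in> cball 0 1 \<Longrightarrow> U x \<le> U y"
    using continuous_attains_sup[OF compact_cball _ Uc] by blast
  show ?thesis
  proof (rule radial_solution_below[OF mu(1), of "U y" U])
    show "U y < 1" using U2 y by blast
    show "0 \<le> U x \<and> U x \<le> U y" if "x \<in> cball 0 1" for x using U2 y that by blast
    fix w :: "real \<Rightarrow> real" and x :: "real ^ 2"
    assume w: "continuous_on {0..1} w" "\<And>r. r \<in> {0..1} \<Longrightarrow> 0 \<le> w r"
      "\<And>x. x \<in> cball 0 1 \<Longrightarrow> w (norm x) \<le> U x" and x: "x \<in> cball 0 1"
    have w1: "w r < 1" if "r \<in> {0..1}" for r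
      using w(3)[of "r *\<^sub>R axis 1 1"] U2[of "r *\<^sub>R axis 1 1"] norm_axis_scaled[OF that, where 'n=2] that
      by auto
    show "potential (\<lambda>t. mu * f (w t)) (norm x) \<le> U x"
      by (rule potential_below_regular[OF mu U w(1,2) w1 w(3) x])
  qed (rule that)
qed

theorem extremal_regular:
  assumes b': "\<And>r. r \<in> {0<..<1} \<Longrightarrow> (b has_real_derivative b' r) (at r)"
    "\<And>r. r \<in> {0<..<1} \<Longrightarrow> b' r \<le> B"
    and f_lim: "filterlim f at_top (at_left 1)"
    and u: "extremal_solution (ball 0 1) c f u"
  shows "regular_solution (ball 0 1) c f (extremal_parameter (ball 0 1) c f) u"
proof -
  define L where "L = extremal_parameter (ball 0 1) c f"
  let ?S = "{lam. 0 < lam \<and> (\<exists>u. regular_solution (ball 0 1) c f lam u)}"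
  have bdd: "bdd_above ?S"
  proof (rule bdd_aboveI)
    fix lam assume "lam \<in> ?S"
    then obtain v where lam: "0 < lam" and v: "regular_solution (ball 0 1) c f lam v" by blast
    obtain w where "radial_solution lam w" using radial_below_regular[OF lam order_refl v] by blast
    then show "lam \<le> 1 / (f 0 * potential (\<lambda>_. 1) 0)" by (rule radial_solution_parameter_bound[OF lam])
  qed
  obtain l0 w0 where l0: "0 < l0" "radial_solution l0 w0" by (rule small_radial_solution)
  have "regular_solution (ball 0 1) c f l0 (\<lambda>x. w0 (norm x))"
    by (rule regular_of_radial[OF l0]) simp
  then have "l0 \<in> ?S" using l0 by blast
  then have "l0 \<le> L" unfolding L_def extremal_parameter_def using bdd by (intro cSup_upper)
  then have L: "0 < L" using l0 by simp
  obtain U where U: "\<And>lam. 0 < lam \<Longrightarrow> lam < L \<Longrightarrow> minimal_solution (ball 0 1) c f lam (U lam)"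
    and Ulim: "\<And>x. x \<in> cball 0 1 \<Longrightarrow> ((\<lambda>lam. U lam x) \<longlongrightarrow> u x) (at_left L)"
    using u unfolding extremal_solution_def L_def[symmetric] closure_ball[OF zero_less_one] by blast
  have U_reg: "regular_solution (ball 0 1) c f lam (U lam)" if "0 < lam" "lam < L" for lam
    using U[OF that] by (simp add: minimal_solution_def)
  have U_le: "U mu x \<le> w (norm x)"
    if mu: "0 < mu" "mu < L" and w: "radial_solution mu w" and x: "x \<in> cball 0 1" for mu w x
  proof (cases "norm x < 1")
    case True
    have "regular_solution (ball 0 1) c f mu (\<lambda>x. w (norm x))"
      by (rule regular_of_radial[OF mu(1) w]) simp
    moreover have "x \<in> ball 0 1" using True by simp
    ultimately show ?thesis using U[OF mu] unfolding minimal_solution_def by blast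
  next
    case False
    then have "x \<in> frontier (ball 0 1)" "norm x = 1" using x by (auto simp: frontier_ball)
    then show ?thesis
      using U_reg[OF mu] radial_solutionD(2)[OF w, of 1] by (auto simp: regular_solution_def)
  qed
  have "\<exists>w. radial_solution lam w \<and> (\<forall>x\<in>cball 0 1. U lam x = w (norm x))"
    if lam: "0 < lam" "lam < L" for lam
  proof -
    obtain w where w: "radial_solution lam w" "\<And>x. x \<in> cball 0 1 \<Longrightarrow> w (norm x) \<le> U lam x"
      using radial_below_regular[OF lam(1) order_refl U_reg[OF lam]] by blast
    then show ?thesis using U_le[OF lam w(1)] by (intro exI[of _ w]) (auto intro!: antisym)
  qed
  then obtain W where W: "\<And>lam. 0 < lam \<Longrightarrow> lam < L \<Longrightarrow> radial_solution lam (W lam)"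
    and UW: "\<And>lam x. 0 < lam \<Longrightarrow> lam < L \<Longrightarrow> x \<in> cball 0 1 \<Longrightarrow> U lam x = W lam (norm x)"
    by metis
  have W_mono: "W mu r \<le> W lam r" if mu: "0 < mu" "mu < lam" "lam < L" and r: "r \<in> {0..1}" for mu lam r
  proof -
    have l: "0 < lam" and m: "mu < L" using mu by auto
    obtain w where w: "radial_solution mu w" "\<And>x. x \<in> cball 0 1 \<Longrightarrow> w (norm x) \<le> U lam x"
      using radial_below_regular[OF mu(1) less_imp_le[OF mu(2)] U_reg[OF l mu(3)]] by blast
    let ?x = "r *\<^sub>R axis 1 1 :: real ^ 2"
    have n: "norm ?x = r" by (rule norm_axis_scaled[OF r])
    then have x: "?x \<in> cball 0 1" using r by simp
    show ?thesis
      using U_le[OF mu(1) m w(1) x] w(2)[OF x] UW[OF mu(1) m x] UW[OF l mu(3) x] n by simp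
  qed
  obtain C where C: "\<And>mu lam u w. 0 < mu \<Longrightarrow> mu < lam \<Longrightarrow> radial_solution mu u \<Longrightarrow>
    radial_solution lam w \<Longrightarrow> (\<And>r. r \<in> {0..1} \<Longrightarrow> u r \<le> w r) \<Longrightarrow> mu * f (u 0) \<le> C"
    using center_bound[OF b'] by blast
  have "\<forall>\<^sub>F t in at_left 1. 2 * C / L + 1 \<le> f t"
    using f_lim by (auto simp: filterlim_at_top)
  then obtain m where m: "m < 1" "\<And>t. m < t \<Longrightarrow> t < 1 \<Longrightarrow> 2 * C / L + 1 \<le> f t"
    using eventually_at_left[of 0 1] by (auto simp: eventually_at_left_field)
  have Wm: "W mu r \<le> m" if mu: "L / 2 \<le> mu" "mu < L" and r: "r \<in> {0..1}" for mu r
  proof -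
    have mu0: "0 < mu" using mu L by simp
    \<comment> \<open>any larger parameter provides the stability of the solution for \<open>mu\<close>\<close>
    obtain lam where lam: "mu < lam" "lam < L" using dense mu by blast
    note Wmu = W[OF mu0 mu(2)]
    have c0: "mu * f (W mu 0) \<le> C"
      using C[OF mu0 lam(1) Wmu W W_mono[OF mu0 lam]] mu0 lam by simp
    have fp: "0 < f (W mu 0)" using f_pos radial_solutionD(2)[OF Wmu] by simp
    have "L / 2 * f (W mu 0) \<le> C"
      using mult_right_mono[OF mu(1) less_imp_le[OF fp]] c0 by linarith
    then have "f (W mu 0) \<le> 2 * C / L" using L by (simp add: field_simps)
    then have "W mu 0 \<le> m" using m(2)[of "W mu 0"] radial_solutionD(2)[OF Wmu, of 0] by force
    moreover have "W mu r \<le> W mu 0" using radial_solution_antimono[OF mu0 Wmu] r by simp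
    ultimately show ?thesis by simp
  qed
  \<comment> \<open>the offset \<open>2\<close> keeps the sequence in \<open>[L / 2, L)\<close>, where the bound \<open>m\<close> is uniform\<close>
  define l where "l n = L - L / (2 + real n)" for n
  have l: "L / 2 \<le> l n" "l n < L" for n
  proof -
    have "L / (2 + real n) \<le> L / 2" using L by (intro divide_left_mono) auto
    then show "L / 2 \<le> l n" by (simp add: l_def)
    show "l n < L" using L by (simp add: l_def)
  qed
  have l0: "0 < l n" for n using l(1)[of n] L by simp
  have l_lim: "l \<longlonglongrightarrow> L"
  proof -
    have "(\<lambda>n. L - L / (2 + real n)) \<longlonglongrightarrow> L - 0"
      by (intro tendsto_diff tendsto_const tendsto_divide_0[OF tendsto_const]
          filterlim_at_top_imp_at_infinity filterlim_tendsto_add_at_top[OF tendsto_const]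
          filterlim_real_sequentially)
    then show ?thesis by (simp add: l_def[abs_def])
  qed
  then have "filterlim l (at_left L) sequentially"
    unfolding filterlim_at using l by (auto intro!: always_eventually simp: less_imp_neq)
  then have Ux: "(\<lambda>n. U (l n) x) \<longlonglongrightarrow> u x" if "x \<in> cball 0 1" for x
    by (rule filterlim_compose[OF Ulim[OF that]])
  have Wlim: "(\<lambda>n. W (l n) (norm x)) \<longlonglongrightarrow> u x" if "x \<in> cball 0 1" for x
    using Ux[OF that] by (simp only: UW[OF l0 l(2) that])
  define V where "V r = u (r *\<^sub>R axis 1 1)" for r
  have V: "(\<lambda>n. W (l n) r) \<longlonglongrightarrow> V r" if r: "r \<in> {0..1}" for r
    using Wlim[of "r *\<^sub>R axis 1 1"] norm_axis_scaled[OF r, where 'n=2] r by (simp add: V_def)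
  have "radial_solution L V"
  proof (rule radial_solution_limit[of "\<lambda>n. W (l n)" m l L])
    note D = radial_solutionD[OF W[OF l0 l(2)]]
    show "continuous_on {0..1} (W (l n))" for n by (rule D(1))
    show "0 \<le> W (l n) r \<and> W (l n) r \<le> m" if "r \<in> {0..1}" for n r
      using D(2)[OF that] Wm[OF l that] by auto
    show "0 \<le> l n \<and> l n \<le> L" for n using l0[of n] l(2)[of n] by simp
    show "(\<lambda>n. potential (\<lambda>t. l n * f (W (l n) t)) r) \<longlonglongrightarrow> V r" if "r \<in> {0..1}" for r
      using V[OF that] D(3)[OF that] by simp
  qed (use m V l_lim in auto)
  moreover have "u x = V (norm x)" if "x \<in> cball 0 1" for x
    using LIMSEQ_unique[OF Wlim[OF that] V] that by simp
  ultimately show ?thesis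
    unfolding L_def[symmetric] by (rule regular_of_radial[OF L])
qed

end

section \<open>Radial potentials\<close>

lemma grad_radial:
  fixes \<gamma> :: "real ^ 'n \<Rightarrow> real"
  assumes \<gamma>: "\<And>x. x \<in> ball 0 1 \<Longrightarrow> \<gamma> x = h (norm x)"
    and h: "(h has_real_derivative d) (at (norm x))" and x: "x \<in> ball 0 1" "x \<noteq> 0"
  shows "grad \<gamma> x = (d / norm x) *\<^sub>R x"
proof -
  have D: "(\<gamma> has_derivative (\<lambda>y. d * (x \<bullet> y / norm x))) (at x)"
    by (rule has_derivative_transform_within_open[OF has_derivative_radial[OF x(2) h] open_ball x(1)])
       (simp add: \<gamma>)
  show ?thesis
    unfolding grad_def vec_eq_iff by (simp add: partial_eqI[OF D] inner_axis)
qed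

lemma bounded_extension:
  fixes u :: "real ^ 'n \<Rightarrow> real"
  assumes "Ck_extends k \<Omega> u" "bounded \<Omega>"
  obtains g B where "continuous_on (closure \<Omega>) g" "\<And>x. x \<in> \<Omega> \<Longrightarrow> g x = u x"
    "\<And>x. x \<in> \<Omega> \<Longrightarrow> \<bar>u x\<bar> \<le> B"
proof -
  obtain g where g: "continuous_on (closure \<Omega>) g" "\<And>x. x \<in> \<Omega> \<Longrightarrow> g x = u x"
    using assms(1) by (cases k) auto
  have "compact (g ` closure \<Omega>)"
    using g(1) assms(2) by (intro compact_continuous_image) (auto simp: compact_closure)
  then obtain B where "\<And>x. x \<in> closure \<Omega> \<Longrightarrow> \<bar>g x\<bar> \<le> B"
    using compact_imp_bounded bounded_iff by (metis imageI real_norm_def)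
  then have "\<bar>u x\<bar> \<le> B" if "x \<in> \<Omega>" for x
    using g(2)[OF that] closure_subset that by fastforce
  with g that show ?thesis by blast
qed

theorem theorem1:
  fixes \<gamma> :: "real ^ 2 \<Rightarrow> real" and c :: "real ^ 2 \<Rightarrow> real ^ 2"
    and f :: "real \<Rightarrow> real" and u :: "real ^ 2 \<Rightarrow> real"
  assumes "smooth_closure (ball 0 1) \<gamma>" and "radial_on (cball 0 1) \<gamma>"
    and "\<forall>x\<in>ball 0 1. c x = grad \<gamma> x"
    and "singular_nonlinearity f"
    and "extremal_solution (ball 0 1) c f u"
  shows "regular_solution (ball 0 1) c f (extremal_parameter (ball 0 1) c f) u"
proof -
  \<comment> \<open>the profile of \<open>\<gamma>\<close> is read off along the first coordinate axis\<close>
  define e :: "real \<Rightarrow> real ^ 2" where "e t = t *\<^sub>R axis 1 1" for t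
  have e: "norm (e t) = t" if "t \<in> {0..1}" for t
    unfolding e_def by (rule norm_axis_scaled[OF that])
  have e_ball: "e t \<in> ball 0 1" if "t \<in> {0<..<1}" for t using e[of t] that by simp
  have e_cball: "e t \<in> cball 0 1" if "t \<in> {0..1}" for t using e[of t] that by simp
  define h where "h t = \<gamma> (e t)" for t
  define p where "p = partial 1 \<gamma>"
  have C2: "Ck_closure 2 (ball 0 1) \<gamma>" using assms(1) by (simp add: smooth_closure_def)
  have \<gamma>c: "continuous_on (cball 0 1) \<gamma>" and d\<gamma>: "\<And>x. x \<in> ball 0 1 \<Longrightarrow> \<gamma> differentiable (at x)"
    and dp: "\<And>x. x \<in> ball 0 1 \<Longrightarrow> p differentiable (at x)"
    and pe: "Ck_extends 1 (ball 0 1) p" and ppe: "Ck_extends 0 (ball 0 1) (partial 1 p)"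
    using C2 by (auto simp: Ck_closure_def numeral_2_eq_2 p_def)
  \<comment> \<open>the advection coefficient must be continuous up to the boundary, and its derivative bounded\<close>
  obtain q where q: "continuous_on (cball 0 1) q" "\<And>x. x \<in> ball 0 1 \<Longrightarrow> q x = p x"
    using bounded_extension[OF pe bounded_ball] by (metis closure_ball zero_less_one)
  obtain B where B: "\<And>x. x \<in> ball 0 1 \<Longrightarrow> \<bar>partial 1 p x\<bar> \<le> B"
    using bounded_extension[OF ppe bounded_ball] by metis
  have ec: "continuous_on {0..1} (\<lambda>t. \<phi> (e t))" if "continuous_on (cball 0 1) \<phi>"
    for \<phi> :: "real ^ 2 \<Rightarrow> real"
    by (rule continuous_on_compose2[OF that]) (auto simp: e_def norm_axis_1 intro!: continuous_intros)
  have line: "((\<lambda>t. \<phi> (e t)) has_real_derivative partial 1 \<phi> (e t)) (at t)"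
    if "\<phi> differentiable (at (e t))" for \<phi> t
    using has_real_derivative_line[of \<phi> 0 t 1] that by (simp add: e_def)
  have dh: "(h has_real_derivative p (e t)) (at t)" if "t \<in> {0<..<1}" for t
    unfolding h_def[abs_def] p_def by (rule line[OF d\<gamma>[OF e_ball[OF that]]])
  define a where "a t = exp (- h t)" for t
  define b where "b t = - q (e t)" for t
  define b' where "b' t = - partial 1 p (e t)" for t
  have \<gamma>h: "\<gamma> x = h (norm x)" if "x \<in> cball 0 1" for x
  proof -
    obtain k where k: "\<And>x. x \<in> cball 0 1 \<Longrightarrow> \<gamma> x = k (norm x)"
      using assms(2) by (auto simp: radial_on_def)
    have "norm x \<in> {0..1}" using that by simp
    then show ?thesis using k[OF that] k[OF e_cball[of "norm x"]] e[of "norm x"] by (simp add: h_def)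
  qed
  have cb: "c x = - (b (norm x) / norm x) *\<^sub>R x" if x: "x \<in> ball 0 1" "x \<noteq> 0" for x
  proof -
    have n: "norm x \<in> {0<..<1}" using x by simp
    have "grad \<gamma> x = (p (e (norm x)) / norm x) *\<^sub>R x"
      by (rule grad_radial[OF _ dh[OF n] x]) (simp add: \<gamma>h)
    then show ?thesis using assms(3) x q(2)[OF e_ball[OF n]] by (simp add: b_def)
  qed
  have db: "(b has_real_derivative b' t) (at t)" if t: "t \<in> {0<..<1}" for t
  proof -
    have "((\<lambda>t. - p (e t)) has_real_derivative b' t) (at t)"
      unfolding b'_def by (rule DERIV_minus[OF line[OF dp[OF e_ball[OF t]]]])
    then show ?thesis
      by (rule has_field_derivative_transform_within_open[of _ _ _ "{0<..<1}"])
         (use t q(2)[OF e_ball] in \<open>auto simp: b_def\<close>)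
  qed
  have b'B: "b' t \<le> B" if "t \<in> {0<..<1}" for t
    using B[OF e_ball[OF that]] by (simp add: b'_def)
  obtain f' where f': "\<And>t. t \<in> {0..<1} \<Longrightarrow> (f has_real_derivative f' t) (at t within {0..<1})"
    using assms(4) unfolding singular_nonlinearity_def C2_unit_def by blast
  interpret radial_advection a b f f' c
  proof
    show "0 < a r" for r by (simp add: a_def)
    show "continuous_on {0..1} a"
      unfolding a_def h_def by (intro continuous_intros ec \<gamma>c)
    show "(a has_real_derivative a r * b r) (at r)" if "r \<in> {0<..<1}" for r
      unfolding a_def[abs_def] using dh[OF that] q(2)[OF e_ball[OF that]]
      by (auto intro!: derivative_eq_intros simp: b_def)
    show "continuous_on {0..1} b"
      unfolding b_def by (intro continuous_intros ec q)
  qed (use assms(4) f' cb in \<open>auto simp: singular_nonlinearity_def\<close>)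
  show ?thesis
    by (rule extremal_regular[OF db b'B]) (use assms(4,5) in \<open>auto simp: singular_nonlinearity_def\<close>)
qed

end
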